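(* Let $T\in\mathrm{SYT}(2^k)$, let $M=M(T)$, and let $W=W(\mathfrak t_T)$ for any weighted triangulation $\mathfrak t_T$ extending $\mathfrak d_T$. Then $a(W,\mathbf w(M))=1$, and $a(W,\mathbf w(M'))=0$ for every noncrossing perfect matching $M'$ of $[2k]$ with $M'\neq M$.
   Context: $\mathrm{SYT}(2^k)$: standard Young tableaux with $k$ rows and $2$ columns, entries $1,\dots,2k$. $M(T)$: the unique noncrossing perfect matching of $1,\dots,2k$ (in cyclic order on a circle) whose arcs $\{i<j\}$ have $i$ in the first column and $j$ in the second column of $T$. A short arc is an arc $\{i,i+1 \bmod 2k\}$; let $i_1<\dots<i_s$ be the $i$ such that $\{i,i+1\bmod 2k\}$ is an arc. Color sets: $C_j=\{i_j+1,\dots,i_{j+1}\}$ (cyclically), i.e. cut the circle between $i$ and $i+1$ for each short arc. $\mathfrak d_T$: weighted dissection of the $s$-gon (vertices $1,\dots,s$ cyclically; sides always included, possibly with weight $0$) in which $\{a,b\}$ has weight equal to the number of arcs of $M(T)$ between $C_a$ and $C_b$, present when positive. A weighted triangulation extending $\mathfrak d_T$ contains all diagonals of $\mathfrak d_T$ with the same weights and gives weight $0$ to additional diagonals (for $s=2$ it is just the edge $\{1,2\}$). $W(\mathfrak t)$: the $\mathrm{SL}_k$ web on boundary vertices $1,\dots,2k$ (colored black) with white interior vertices $w_1,\dots,w_s$, a black interior vertex $b(t)$ per triangle $t$ joined to $w_a,w_b,w_c$ for its vertices $a,b,c$, and a multiplicity-one edge from $w_j$ to each boundary vertex in $C_j$;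 the multiplicity of $b(t)w_a$ is the total weight of the diagonals (including sides) in the sub-polygon on the far side of side $bc$ of $t$, including $bc$, and similarly for the other two edges. A consistent labeling $\ell$ of a web assigns to each edge $e$ a subset $\ell(e)\subseteq[k]$ with $|\ell(e)|=\mathrm{mult}(e)$, such that $\ell(e)\cap\ell(e')=\emptyset$ whenever $e\neq e'$ share a vertex. Its boundary word is $\ell(e_1)\cdots\ell(e_{2k})$, where $e_i$ is the edge at boundary vertex $i$. For a word $\mathbf w$, $a(W,\mathbf w)$ is the number of consistent labelings of $W$ with boundary word $\mathbf w$. For a noncrossing perfect matching $M'$ of $[2k]$, $\mathbf w(M')$ is the word of length $2k$ in which the two endpoints of the $j$-th arc (for some fixed numbering of the $k$ arcs by $1,\dots,k$) both carry the symbol $j$. *)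

theory Defs
  imports Main "HOL-Library.FuncSet" "HOL-Library.Disjoint_Sets"
begin

text \<open>The entry in row \<open>r\<close> and column \<open>c\<close> of a tableau is \<open>T r c\<close>, with \<open>1 \<le> r \<le> k\<close> and
  \<open>c \<in> {1, 2}\<close>; values at other arguments are irrelevant.\<close>

definition two_column_SYT :: "nat \<Rightarrow> (nat \<Rightarrow> nat \<Rightarrow> nat) \<Rightarrow> bool" where
  "two_column_SYT k T \<longleftrightarrow>
     bij_betw (\<lambda>(r, c). T r c) ({1..k} \<times> {1..2}) {1..2 * k} \<and>
     (\<forall>r\<in>{1..k}. T r 1 < T r 2) \<and>
     (\<forall>c\<in>{1..2}. \<forall>r\<in>{1..k}. \<forall>r'\<in>{1..k}. r < r' \<longrightarrow> T r c < T r' c)"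

definition column :: "nat \<Rightarrow> (nat \<Rightarrow> nat \<Rightarrow> nat) \<Rightarrow> nat \<Rightarrow> nat set" where
  "column k T c = (\<lambda>r. T r c) ` {1..k}"

text \<open>Arcs of a matching and chords of a polygon are two-element sets of positions on a circle.
  Two of them cross iff their endpoints strictly alternate.\<close>

definition crossing :: "nat set \<Rightarrow> nat set \<Rightarrow> bool" where
  "crossing d e \<longleftrightarrow>
     (\<exists>p q r s. p < q \<and> q < r \<and> r < s \<and>
        (d = {p, r} \<and> e = {q, s} \<or> d = {q, s} \<and> e = {p, r}))"

definition noncrossing :: "nat set set \<Rightarrow> bool" where
  "noncrossing D \<longleftrightarrow> (\<forall>d\<in>D. \<forall>e\<in>D. \<not> crossing d e)"

definition perfect_matching :: "nat \<Rightarrow> nat set set \<Rightarrow> bool" where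
  "perfect_matching n M \<longleftrightarrow> partition_on {1..n} M \<and> (\<forall>e\<in>M. card e = 2)"

definition matching_of :: "nat \<Rightarrow> (nat \<Rightarrow> nat \<Rightarrow> nat) \<Rightarrow> nat set set" where
  "matching_of k T =
     (THE M. perfect_matching (2 * k) M \<and> noncrossing M \<and>
        (\<forall>i j. i < j \<and> {i, j} \<in> M \<longrightarrow> i \<in> column k T 1 \<and> j \<in> column k T 2))"


text \<open>The cyclic successor of \<open>i\<close> in \<open>{1..n}\<close> is \<open>i mod n + 1\<close>. In particular, for \<open>n = 2\<close> both
  \<open>1\<close> and \<open>2\<close> are starting points of the short arc \<open>{1, 2}\<close>.\<close>

definition short_arc_starts :: "nat \<Rightarrow> nat set set \<Rightarrow> nat set" where
  "short_arc_starts n M = {i \<in> {1..n}. {i, i mod n + 1} \<in> M}"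

definition num_short_arcs :: "nat \<Rightarrow> nat set set \<Rightarrow> nat" where
  "num_short_arcs n M = card (short_arc_starts n M)"

definition short_arc_start :: "nat \<Rightarrow> nat set set \<Rightarrow> nat \<Rightarrow> nat" where
  "short_arc_start n M j = sorted_list_of_set (short_arc_starts n M) ! (j - 1)"

definition color_set :: "nat \<Rightarrow> nat set set \<Rightarrow> nat \<Rightarrow> nat set" where
  "color_set n M j =
     (if j < num_short_arcs n M
      then {short_arc_start n M j + 1..short_arc_start n M (j + 1)}
      else {short_arc_start n M j + 1..n} \<union> {1..short_arc_start n M 1})"


definition chords :: "nat \<Rightarrow> nat set set" where
  "chords s = {{a, b} | a b. a \<in> {1..s} \<and> b \<in> {1..s} \<and> a \<noteq> b}"

definition sides :: "nat \<Rightarrow> nat set set" where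
  "sides s = {{a, a mod s + 1} | a. a \<in> {1..s}}"

text \<open>Weights are only meaningful on the elements of \<open>diags\<close>, which include the sides.\<close>

record weighted_dissection =
  diags :: "nat set set"
  weight :: "nat set \<Rightarrow> nat"

definition num_arcs_between :: "nat \<Rightarrow> nat set set \<Rightarrow> nat set \<Rightarrow> nat" where
  "num_arcs_between n M d =
     card {e \<in> M. \<exists>a b x y. d = {a, b} \<and> e = {x, y} \<and> x \<in> color_set n M a \<and> y \<in> color_set n M b}"

definition dissection_of :: "nat \<Rightarrow> nat set set \<Rightarrow> weighted_dissection" where
  "dissection_of n M =
     \<lparr>diags = sides (num_short_arcs n M) \<union>
        {d \<in> chords (num_short_arcs n M). num_arcs_between n M d > 0},
      weight = num_arcs_between n M\<rparr>"

text \<open>Triangulations are the maximal noncrossing sets of chords; since sides cross no chord, they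
  are automatically included. The only triangulation of the \<open>2\<close>-gon is \<open>{{1, 2}}\<close>.\<close>

definition triangulation :: "nat \<Rightarrow> nat set set \<Rightarrow> bool" where
  "triangulation s E \<longleftrightarrow> E \<subseteq> chords s \<and> noncrossing E \<and>
     (\<forall>E'. E \<subseteq> E' \<and> E' \<subseteq> chords s \<and> noncrossing E' \<longrightarrow> E' = E)"

definition triangulation_extending ::
    "nat \<Rightarrow> weighted_dissection \<Rightarrow> weighted_dissection \<Rightarrow> bool" where
  "triangulation_extending s \<dd> \<tt> \<longleftrightarrow>
     triangulation s (diags \<tt>) \<and> diags \<dd> \<subseteq> diags \<tt> \<and>
     (\<forall>d\<in>diags \<dd>. weight \<tt> d = weight \<dd> d) \<and>
     (\<forall>d\<in>diags \<tt> - diags \<dd>. weight \<tt> d = 0)"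

text \<open>In a triangulation of a convex polygon, every triple of pairwise joined vertices bounds a
  triangular face.\<close>

definition triangles :: "weighted_dissection \<Rightarrow> nat set set" where
  "triangles \<tt> = {{a, b, c} | a b c. a \<noteq> b \<and> b \<noteq> c \<and> a \<noteq> c \<and>
     {a, b} \<in> diags \<tt> \<and> {b, c} \<in> diags \<tt> \<and> {a, c} \<in> diags \<tt>}"

text \<open>For a triangle \<open>t\<close> with vertices \<open>a, b, c\<close>, the set \<open>far_side s t a\<close> consists of the vertices
  of the sub-polygon cut off by the side \<open>bc\<close> that does not contain \<open>a\<close> (with \<open>b\<close> and \<open>c\<close>
  included).\<close>

definition far_side :: "nat \<Rightarrow> nat set \<Rightarrow> nat \<Rightarrow> nat set" where
  "far_side s t a =
     (let b = Min (t - {a}); c = Max (t - {a})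
      in if b < a \<and> a < c then {1..b} \<union> {c..s} else {b..c})"

definition far_weight :: "nat \<Rightarrow> weighted_dissection \<Rightarrow> nat set \<Rightarrow> nat \<Rightarrow> nat" where
  "far_weight s \<tt> t a = (\<Sum>d \<in> {d \<in> diags \<tt>. d \<subseteq> far_side s t a}. weight \<tt> d)"


text \<open>A web is a bipartite graph with edge multiplicities, and an edge is the pair of its black and
  its white endpoint. All boundary vertices are black and are listed in their order on the
  boundary. The planar embedding is not recorded, because consistent labelings do not depend on
  it. Edges of multiplicity \<open>0\<close> are allowed; they can only be labeled by the empty set.\<close>

record ('b, 'w) web =
  boundary :: "'b list"
  interior_black :: "'b set"
  interior_white :: "'w set"
  edges :: "('b \<times> 'w) set"
  mult :: "'b \<times> 'w \<Rightarrow> nat"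

datatype black_vertex = Bdry nat | Tri "nat set"

text \<open>The white vertex \<open>w\<^sub>j\<close> is represented by the number \<open>j\<close>.\<close>

definition web_of :: "nat \<Rightarrow> nat set set \<Rightarrow> weighted_dissection \<Rightarrow> (black_vertex, nat) web" where
  "web_of n M \<tt> = (let s = num_short_arcs n M in
     \<lparr>boundary = map Bdry [1..<n + 1],
      interior_black = Tri ` triangles \<tt>,
      interior_white = {1..s},
      edges = {(Bdry i, j) | i j. j \<in> {1..s} \<and> i \<in> color_set n M j} \<union>
              {(Tri t, a) | t a. t \<in> triangles \<tt> \<and> a \<in> t},
      mult = (\<lambda>(v, a). case v of Bdry i \<Rightarrow> 1 | Tri t \<Rightarrow> far_weight s \<tt> t a)\<rparr>)"

text \<open>Labelings are extensional functions on the edge set, so that they can be counted.\<close>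

definition consistent_labeling ::
    "nat \<Rightarrow> ('b, 'w) web \<Rightarrow> ('b \<times> 'w \<Rightarrow> nat set) \<Rightarrow> bool" where
  "consistent_labeling k W l \<longleftrightarrow>
     l \<in> edges W \<rightarrow>\<^sub>E Pow {1..k} \<and>
     (\<forall>e\<in>edges W. card (l e) = mult W e) \<and>
     (\<forall>e\<in>edges W. \<forall>e'\<in>edges W.
        e \<noteq> e' \<and> (fst e = fst e' \<or> snd e = snd e') \<longrightarrow> l e \<inter> l e' = {})"

definition boundary_edge :: "('b, 'w) web \<Rightarrow> 'b \<Rightarrow> 'b \<times> 'w" where
  "boundary_edge W v = (THE e. e \<in> edges W \<and> fst e = v)"

definition boundary_word :: "('b, 'w) web \<Rightarrow> ('b \<times> 'w \<Rightarrow> nat set) \<Rightarrow> nat set list" where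
  "boundary_word W l = map (\<lambda>v. l (boundary_edge W v)) (boundary W)"

text \<open>Boundary edges have multiplicity \<open>1\<close>; a symbol \<open>x\<close> of the word \<open>w\<close> stands for the label
  \<open>{x}\<close>.\<close>

definition num_labelings :: "nat \<Rightarrow> ('b, 'w) web \<Rightarrow> nat list \<Rightarrow> nat" where
  "num_labelings k W w =
     card {l. consistent_labeling k W l \<and> boundary_word W l = map (\<lambda>x. {x}) w}"

definition matching_word :: "nat \<Rightarrow> nat set set \<Rightarrow> (nat set \<Rightarrow> nat) \<Rightarrow> nat list" where
  "matching_word k M \<nu> = map (\<lambda>i. \<nu> (THE e. e \<in> M \<and> i \<in> e)) [1..<2 * k + 1]"

end

theory Submission
  imports Defs
begin

text \<open>Colour the position \<open>i\<close> by the \<open>j\<close> with \<open>i \<in> C\<^sub>j\<close>, and consider a consistent labeling whose boundary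
  word comes from a noncrossing matching \<open>M'\<close>. The multiplicities at a triangle sum to \<open>k\<close>, so every
  symbol selects one edge at each triangle. It thereby matches the triangles injectively to the
  polygon vertices other than the two colours of its arc.

  A proper cyclic interval \<open>A\<close> of polygon vertices meets at least \<open>card A - 1\<close> triangles in two or more
  vertices. By the pigeonhole principle, a symbol with both colours in \<open>A\<close> therefore selects, at one of
  these triangles \<open>t\<close>, a vertex \<open>e\<close> outside \<open>A\<close>. If \<open>A\<close> is the far side of \<open>t\<close> opposite \<open>e\<close>, this can only
  be \<open>t\<close> itself: all arcs of \<open>M'\<close> on the far side must appear on the edge \<open>(t, e)\<close>. The multiplicity of
  that edge is the number of arcs of \<open>M\<close> on the far side.

  Let \<open>{p, q}\<close> be an arc of \<open>M'\<close> inside which \<open>M'\<close> and \<open>M\<close> agree, and let \<open>A\<close> be the set of colours from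
  \<open>p\<close> to \<open>q\<close>. If \<open>{p, q} \<notin> M\<close>, then all arcs of \<open>M\<close> with colours in \<open>A\<close> lie inside \<open>{p, q}\<close> and belong
  to \<open>M'\<close>, so the edge \<open>(t, e)\<close> obtained for \<open>{p, q}\<close> carries one label more than its multiplicity.
  Hence \<open>M' = M\<close> by induction on the length of arcs, and then the forced labels are all labels.\<close>

section \<open>Noncrossing matchings\<close>

text \<open>The bounds are weak because edges of a triangulation may share an endpoint; for
  matchings \<open>nested\<close> sharpens them.\<close>

lemma noncrossingD:
  assumes "noncrossing D" "{p, r} \<in> D" "{q, s} \<in> D" "p < q" "q < r"
  shows "p \<le> s \<and> s \<le> r"
proof (rule ccontr)
  assume "\<not> (p \<le> s \<and> s \<le> r)"
  then have "s < p \<or> r < s" by auto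
  then have "crossing {p, r} {q, s}"
  proof
    assume "s < p"
    then show ?thesis unfolding crossing_def using assms(4,5)
      by (intro exI[of _ s] exI[of _ p] exI[of _ q] exI[of _ r]) (auto simp: insert_commute)
  next
    assume "r < s"
    then show ?thesis unfolding crossing_def using assms(4,5)
      by (intro exI[of _ p] exI[of _ q] exI[of _ r] exI[of _ s]) auto
  qed
  then show False using assms(1-3) unfolding noncrossing_def by blast
qed

lemma noncrossingI:
  assumes "\<And>p q r s. {p, r} \<in> D \<Longrightarrow> {q, s} \<in> D \<Longrightarrow> p < q \<Longrightarrow> q < r \<Longrightarrow> r < s \<Longrightarrow> False"
  shows "noncrossing D"
  unfolding noncrossing_def crossing_def using assms by metis

lemma card_two_natE:
  fixes e :: "nat set"
  assumes "card e = 2"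
  obtains p q where "p < q" "e = {p, q}"
proof -
  from assms obtain x y where "e = {x, y}" "x \<noteq> y" by (auto simp: card_2_iff)
  then show ?thesis using that[of x y] that[of y x] by (cases "x < y") (auto simp: insert_commute)
qed

section \<open>Arcs of a noncrossing perfect matching\<close>

locale noncrossing_matching =
  fixes n :: nat and M :: "nat set set"
  assumes perfect: "perfect_matching n M" and noncrossing: "noncrossing M"
begin

lemma partition: "partition_on {1..n} M"
  using perfect by (simp add: perfect_matching_def)

lemma arcE:
  assumes "e \<in> M"
  obtains p q where "p < q" "e = {p, q}"
  using assms perfect card_two_natE by (metis perfect_matching_def)

lemma arc_bounds:
  assumes "{i, j} \<in> M"
  shows "i \<in> {1..n}" "j \<in> {1..n}" "i \<noteq> j"
proof -
  show "i \<in> {1..n}" "j \<in> {1..n}" using assms partition unfolding partition_on_def by blast+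
  have "card {i, j} = 2" using assms perfect by (simp add: perfect_matching_def)
  then show "i \<noteq> j" by auto
qed

lemma arcs_eqI: "e \<in> M \<Longrightarrow> e' \<in> M \<Longrightarrow> i \<in> e \<Longrightarrow> i \<in> e' \<Longrightarrow> e = e'"
  using partition unfolding partition_on_def disjoint_def by blast

lemma arc_unique: "{i, j} \<in> M \<Longrightarrow> {i, j'} \<in> M \<Longrightarrow> j = j'"
  using arcs_eqI[of "{i, j}" "{i, j'}" i] by (auto simp: doubleton_eq_iff)

lemma partner:
  assumes "i \<in> {1..n}"
  obtains j where "{i, j} \<in> M" "j \<noteq> i"
proof -
  from assms obtain e where e: "e \<in> M" "i \<in> e" using partition unfolding partition_on_def by blast
  then obtain p q where "p < q" "e = {p, q}" using arcE by blast
  with e that[of p] that[of q] show ?thesis by (auto simp: insert_commute)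
qed

lemma nested:
  assumes "{p, r} \<in> M" "{q, t} \<in> M" "p < q" "q < r"
  shows "p < t" "t < r"
proof -
  have "p \<le> t \<and> t \<le> r" using noncrossingD[OF noncrossing assms] .
  moreover have "t \<noteq> p" using arc_unique[of p r q] assms by (auto simp: insert_commute)
  moreover have "t \<noteq> r" using arc_unique[of r p q] assms by (auto simp: insert_commute)
  ultimately show "p < t" "t < r" by auto
qed

text \<open>Unless \<open>q = p + 1\<close>, the arc at \<open>p + 1\<close> is nested strictly
  inside {p, q} and hence shorter, so the descent ends at a short arc.\<close>

lemma short_arc_inside:
  assumes "{p, q} \<in> M" "p < q"
  shows "\<exists>i. p \<le> i \<and> i < q \<and> {i, i + 1} \<in> M"
  using assms
proof (induction "q - p" arbitrary: p q rule: less_induct)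
  case less
  show ?case
  proof (cases "q = p + 1")
    case True
    then show ?thesis using less.prems by (intro exI[of _ p]) auto
  next
    case False
    have "p + 1 \<in> {1..n}" using arc_bounds[OF less.prems(1)] less.prems(2) by auto
    then obtain t where t: "{p + 1, t} \<in> M" "t \<noteq> p + 1" by (rule partner)
    have "p < t" "t < q" using nested[OF less.prems(1) t(1)] False less.prems(2) by auto
    then have "t - (p + 1) < q - p" "p + 1 < t" using t(2) by auto
    then obtain i where "p + 1 \<le> i" "i < t" "{i, i + 1} \<in> M"
      using less.hyps[of t "p + 1"] t(1) by blast
    then show ?thesis using \<open>t < q\<close> by (intro exI[of _ i]) auto
  qed
qed

lemma the_arc: "e \<in> M \<Longrightarrow> i \<in> e \<Longrightarrow> (THE e. e \<in> M \<and> i \<in> e) = e"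
  using arcs_eqI by (intro the_equality) auto

lemma finite_matching: "finite M" "finite (\<Union>M)"
  using partition by (auto simp: partition_on_def intro: finite_UnionD)

end

section \<open>Comparison, existence and uniqueness of noncrossing matchings\<close>

text \<open>Induction on the length of arcs of \<open>M'\<close>: shorter arcs being already in
  \<open>M\<close>, the two matchings agree strictly inside the current arc, which is what
  \<open>step\<close> may use. Both the uniqueness of M(T) and the identity of \<open>M'\<close> and
  \<open>M\<close> are obtained this way.\<close>

lemma noncrossing_matching_eqI:
  assumes M': "noncrossing_matching n M'" and M: "noncrossing_matching n M"
    and step: "\<And>p q. {p, q} \<in> M' \<Longrightarrow> p < q \<Longrightarrow>
      (\<And>u v. p < u \<Longrightarrow> u < q \<Longrightarrow> {u, v} \<in> M \<longleftrightarrow> {u, v} \<in> M') \<Longrightarrow> {p, q} \<in> M"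
  shows "M' = M"
proof -
  interpret M': noncrossing_matching n M' by fact
  interpret M: noncrossing_matching n M by fact
  have arc: "{p, q} \<in> M" if "{p, q} \<in> M'" "p < q" for p q
    using that
  proof (induction "q - p" arbitrary: p q rule: less_induct)
    case less
    have inner: "{u, v} \<in> M" if "{u, v} \<in> M'" "p < u" "u < q" for u v
    proof -
      have "p < v" "v < q" using M'.nested[OF less.prems(1) that] by auto
      moreover have "u \<noteq> v" using M'.arc_bounds[OF that(1)] by auto
      ultimately show ?thesis using less.hyps[of v u] less.hyps[of u v] that
        by (cases "u < v") (auto simp: insert_commute)
    qed
    have "{u, v} \<in> M \<longleftrightarrow> {u, v} \<in> M'" if u: "p < u" "u < q" for u v
    proof -
      have "u \<in> {1..n}" using M'.arc_bounds[OF less.prems(1)] u by auto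
      then obtain w where w: "{u, w} \<in> M'" by (rule M'.partner)
      then show ?thesis using inner[OF w u] M.arc_unique[of u v w] M'.arc_unique[of u v w] by auto
    qed
    then show ?case using step less.prems by blast
  qed
  have sub: "M' \<subseteq> M" using arc M'.arcE by (metis subsetI)
  moreover have "M \<subseteq> M'"
  proof
    fix e assume e: "e \<in> M"
    then obtain p q where pq: "p < q" "e = {p, q}" using M.arcE by blast
    then have "p \<in> {1..n}" using M.arc_bounds e by auto
    then obtain t where t: "{p, t} \<in> M'" by (rule M'.partner)
    then have "q = t" using sub e pq M.arc_unique by blast
    then show "e \<in> M'" using t pq by simp
  qed
  ultimately show ?thesis by blast
qed

text \<open>The map \<open>f\<close> certifies the ballot condition: it sends each opener to its own
  larger closer. The ground set is an arbitrary finite set so that the induction can delete an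
  adjacent pair and keep the other positions.\<close>

lemma noncrossing_matching_with_openers:
  fixes X U :: "nat set"
  assumes "finite X" "U \<subseteq> X" "bij_betw f U (X - U)" "\<And>u. u \<in> U \<Longrightarrow> u < f u"
  shows "\<exists>M. partition_on X M \<and> (\<forall>e\<in>M. card e = 2) \<and> noncrossing M \<and>
    (\<forall>i j. i < j \<and> {i, j} \<in> M \<longrightarrow> i \<in> U \<and> j \<in> X - U)"
  using assms
proof (induction "card X" arbitrary: X U f rule: less_induct)
  case less
  show ?case
  proof (cases "X = {}")
    case True
    then show ?thesis by (intro exI[of _ "{}"]) (auto simp: noncrossing_def partition_on_empty)
  next
    case False
    have fimg: "f ` U = X - U" and finj: "inj_on f U" using less.prems(3) by (auto simp: bij_betw_def)
    have "X - U \<noteq> {}" using False fimg by (metis Diff_empty image_is_empty)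
    \<comment> \<open>The first closer and the last opener before it are adjacent in
      \<open>X\<close>, so the arc joining them crosses nothing.\<close>
    define q where "q = Min (X - U)"
    have q: "q \<in> X - U" and q_min: "\<And>x. x \<in> X - U \<Longrightarrow> q \<le> x"
      using Min_in[of "X - U"] Min_le[of "X - U"] \<open>X - U \<noteq> {}\<close> less.prems(1) unfolding q_def
      by simp_all
    obtain u where u: "u \<in> U" "f u = q" using q fimg by (metis imageE)
    define p where "p = Max {v \<in> U. v < q}"
    have fin: "finite {v \<in> U. v < q}" by auto
    have "u \<in> {v \<in> U. v < q}" using u less.prems(4) by auto
    then have "p \<in> {v \<in> U. v < q}" unfolding p_def using Max_in[OF fin] by blast
    then have p: "p \<in> U" "p < q" by auto
    have p_max: "v \<le> p" if "v \<in> U" "v < q" for v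
      using that Max_ge[OF fin] unfolding p_def by simp
    have "u \<le> p" using p_max u less.prems(4) by auto
    have gap: "x = p \<or> x = q" if "x \<in> X" "p \<le> x" "x \<le> q" for x
      using that p_max[of x] q_min[of x] by force
    \<comment> \<open>The opener \<open>p\<close> is paired with the adjacent closer \<open>q\<close>, and \<open>u \<le> p\<close> takes over the partner of \<open>p\<close>.\<close>
    define g where "g = f(u := f p)"
    define Y where "Y = X - {p, q}"
    have fp: "f p \<in> X - U" using p fimg by auto
    have gbij: "bij_betw g (U - {p}) (Y - (U - {p}))"
    proof -
      have "g ` (U - {p}) = f ` U - {q}"
      proof -
        have "g ` (U - {p}) = f ` (U - {u})"
        proof (cases "u = p")
          case True
          then show ?thesis unfolding g_def by auto
        next
          case False
          then have "U - {p} = insert u (U - {u, p})" "U - {u} = insert p (U - {u, p})"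
            using u p by auto
          moreover have "g ` (U - {u, p}) = f ` (U - {u, p})" "g u = f p" unfolding g_def by auto
          ultimately show ?thesis by simp
        qed
        also have "\<dots> = f ` U - {q}" using u finj by (auto simp: inj_on_def)
        finally show ?thesis .
      qed
      moreover have "Y - (U - {p}) = X - U - {q}" unfolding Y_def using p q by auto
      moreover have "inj_on g (U - {p})"
        unfolding g_def using u p finj by (auto simp: inj_on_def)
      ultimately show ?thesis using fimg by (simp add: bij_betw_def)
    qed
    \<comment> \<open>At \<open>u\<close> the new value is \<open>f p\<close>, and
      \<open>u <= p < f p\<close>.\<close>
    have gless: "v < g v" if "v \<in> U - {p}" for v
      using that less.prems(4) p \<open>u \<le> p\<close> unfolding g_def by (auto intro: le_less_trans)
    have "card Y < card X" unfolding Y_def using less.prems(1) p less.prems(2)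
      by (intro psubset_card_mono) auto
    moreover have "finite Y" "U - {p} \<subseteq> Y" using less.prems(1,2) p q unfolding Y_def by auto
    ultimately obtain M where M: "partition_on Y M" "\<forall>e\<in>M. card e = 2" "noncrossing M"
      "\<forall>i j. i < j \<and> {i, j} \<in> M \<longrightarrow> i \<in> U - {p} \<and> j \<in> Y - (U - {p})"
      using less.hyps[OF _ _ _ gbij gless] by auto
    let ?M = "insert {p, q} M"
    have X: "X = {p, q} \<union> Y" "disjnt {p, q} Y" using p q less.prems(2) by (auto simp: Y_def disjnt_def)
    have sub: "\<And>e. e \<in> M \<Longrightarrow> e \<subseteq> Y" using M(1) by (auto simp: partition_on_def)
    have "partition_on X ?M"
      using M(1) X by (auto simp: partition_on_def disjoint_def disjnt_def)
    moreover have "\<forall>e\<in>?M. card e = 2" using M(2) p(2) by auto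
    moreover have "noncrossing ?M"
    proof (rule noncrossingI)
      fix a b c d assume ab: "{a, c} \<in> ?M" "{b, d} \<in> ?M" "a < b" "b < c" "c < d"
      have in_X: "a \<in> X" "b \<in> X" "c \<in> X" "d \<in> X" using ab(1,2) sub X(1) by auto
      show False
      proof (cases "{a, c} \<in> M \<and> {b, d} \<in> M")
        case True
        then show False using noncrossingD[OF M(3), of a c b d] ab by auto
      next
        case False
        then consider "{a, c} = {p, q}" | "{b, d} = {p, q}" using ab by auto
        then show False
        proof cases
          case 1
          then have "a = p" "c = q" using ab p by (auto simp: doubleton_eq_iff)
          then show False using gap[of b] ab in_X by auto
        next
          case 2
          then have "b = p" "d = q" using ab p by (auto simp: doubleton_eq_iff)
          then show False using gap[of c] ab in_X by auto
        qed
      qed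
    qed
    moreover have "\<forall>i j. i < j \<and> {i, j} \<in> ?M \<longrightarrow> i \<in> U \<and> j \<in> X - U"
    proof (intro allI impI)
      fix i j assume ij: "i < j \<and> {i, j} \<in> ?M"
      show "i \<in> U \<and> j \<in> X - U"
      proof (cases "{i, j} = {p, q}")
        case True
        then have "i = p" "j = q" using ij p by (auto simp: doubleton_eq_iff)
        then show ?thesis using p q by simp
      next
        case False
        then show ?thesis using M(4) ij unfolding Y_def by blast
      qed
    qed
    ultimately show ?thesis by blast
  qed
qed

text \<open>The definite description in \<open>matching_of\<close> is meaningful: each row sends a
  first-column entry to a larger second-column entry, which gives existence, and the openers and
  closers determine the arcs, which gives uniqueness.\<close>

lemma noncrossing_matching_of:
  assumes "two_column_SYT k T"
  shows "noncrossing_matching (2 * k) (matching_of k T)"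
proof -
  let ?P = "\<lambda>M. perfect_matching (2 * k) M \<and> noncrossing M \<and>
    (\<forall>i j. i < j \<and> {i, j} \<in> M \<longrightarrow> i \<in> column k T 1 \<and> j \<in> column k T 2)"
  have bij: "bij_betw (\<lambda>(r, c). T r c) ({1..k} \<times> {1..2}) {1..2 * k}"
    and rows: "\<And>r. r \<in> {1..k} \<Longrightarrow> T r 1 < T r 2"
    using assms by (auto simp: two_column_SYT_def)
  have two: "{1..2::nat} = {1, 2}" by auto
  have inj: "T r c = T r' c' \<Longrightarrow> r = r' \<and> c = c'"
    if "r \<in> {1..k}" "r' \<in> {1..k}" "c \<in> {1, 2}" "c' \<in> {1, 2}" for r r' c c'
    using inj_onD[OF bij_betw_imp_inj_on[OF bij], of "(r, c)" "(r', c')"] that unfolding two by simp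
  have union: "{1..2 * k} = column k T 1 \<union> column k T 2"
  proof -
    have "{1..2 * k} = (\<lambda>(r, c). T r c) ` ({1..k} \<times> {1, 2})"
      using bij unfolding bij_betw_def two by simp
    then show ?thesis unfolding column_def by auto
  qed
  have disj: "column k T 1 \<inter> column k T 2 = {}"
  proof (rule ccontr)
    assume "column k T 1 \<inter> column k T 2 \<noteq> {}"
    then obtain r r' where "r \<in> {1..k}" "r' \<in> {1..k}" "T r 1 = T r' 2"
      unfolding column_def by blast
    then show False using inj[of r r' 1 2] by auto
  qed
  define g where "g = the_inv_into {1..k} (\<lambda>r. T r 1)"
  have inj1: "inj_on (\<lambda>r. T r 1) {1..k}" "inj_on (\<lambda>r. T r 2) {1..k}"
    using inj unfolding inj_on_def by blast+
  have g: "bij_betw g (column k T 1) {1..k}"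
    unfolding g_def column_def using inj1 by (intro bij_betw_the_inv_into) (auto simp: bij_betw_def)
  have Tg: "T (g u) 1 = u" if "u \<in> column k T 1" for u
    using that f_the_inv_into_f[OF inj1(1)] unfolding g_def column_def by blast
  have "bij_betw (\<lambda>r. T r 2) {1..k} (column k T 2)"
    using inj1 by (auto simp: bij_betw_def column_def)
  with g have b: "bij_betw ((\<lambda>r. T r 2) \<circ> g) (column k T 1) (column k T 2)" by (rule bij_betw_trans)
  have col2: "{1..2 * k} - column k T 1 = column k T 2" using union disj by blast
  have "\<exists>M. ?P M"
  proof -
    have "u < ((\<lambda>r. T r 2) \<circ> g) u" if "u \<in> column k T 1" for u
      using rows[of "g u"] Tg[OF that] bij_betwE[OF g] that by auto
    moreover have "column k T 1 \<subseteq> {1..2 * k}" using union by blast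
    ultimately show ?thesis
      using noncrossing_matching_with_openers[of "{1..2 * k}" "column k T 1" "(\<lambda>r. T r 2) \<circ> g"] b
      unfolding col2 perfect_matching_def by (simp add: conj_assoc)
  qed
  moreover have "M1 = M2" if P1: "?P M1" and P2: "?P M2" for M1 M2
  proof (rule noncrossing_matching_eqI)
    show 1: "noncrossing_matching (2 * k) M1" and 2: "noncrossing_matching (2 * k) M2"
      using that by (simp_all add: noncrossing_matching_def)
    interpret M1: noncrossing_matching "2 * k" M1 by fact
    interpret M2: noncrossing_matching "2 * k" M2 by fact
    fix p q assume pq: "{p, q} \<in> M1" "p < q"
      and inner: "\<And>u v. p < u \<Longrightarrow> u < q \<Longrightarrow> {u, v} \<in> M2 \<longleftrightarrow> {u, v} \<in> M1"
    have U: "p \<in> column k T 1" "q \<in> column k T 2" using P1 pq by auto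
    \<comment> \<open>Inside {p, q} the matchings agree, so the partners of \<open>p\<close> and
      \<open>q\<close> in \<open>M2\<close> are not strictly inside; as \<open>p\<close> is an
      opener and \<open>q\<close> a closer, \<open>q \<le> p'\<close> and \<open>q' \<le> p\<close>.
      If \<open>q < p'\<close>, the two arcs would cross or share the endpoint
      \<open>p\<close>.\<close>
    obtain p' where p': "{p, p'} \<in> M2" "p' \<noteq> p" using M2.partner[OF M1.arc_bounds(1)[OF pq(1)]] .
    obtain q' where q': "{q, q'} \<in> M2" "q' \<noteq> q" using M2.partner[OF M1.arc_bounds(2)[OF pq(1)]] .
    have "\<not> p' < p"
    proof
      assume "p' < p"
      then have "p \<in> column k T 2" using P2 p' by (auto simp: insert_commute)
      then show False using U disj by blast
    qed
    moreover have "\<not> q < q'"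
    proof
      assume "q < q'"
      then have "q \<in> column k T 1" using P2 q' by auto
      then show False using U disj by blast
    qed
    moreover have "\<not> (p < p' \<and> p' < q)"
      using inner[of p' p] p' M1.nested[OF pq(1), of p' p] by (auto simp: insert_commute)
    moreover have "\<not> (p < q' \<and> q' < q)"
      using inner[of q' q] q' M1.nested[OF pq(1), of q' q] by (auto simp: insert_commute)
    ultimately have "q \<le> p'" "q' \<le> p" using p' q' by auto
    moreover have "\<not> (q < p')"
      using M2.nested[OF p'(1) q'(1)] \<open>q' \<le> p\<close> pq by auto
    ultimately show "{p, q} \<in> M2" using p'(1) by (metis le_neq_implies_less)
  qed
  ultimately have "\<exists>!M. ?P M" by blast
  then have "?P (matching_of k T)" unfolding matching_of_def by (rule theI')
  then show ?thesis by (simp add: noncrossing_matching_def)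
qed

section \<open>Triangulated polygons\<close>

locale triangulated_polygon =
  fixes s :: nat and \<tt> :: weighted_dissection
  assumes triangulation: "triangulation s (diags \<tt>)"
begin

abbreviation E :: "nat set set" where "E \<equiv> diags \<tt>"

lemma edge_chord: "E \<subseteq> chords s" and edges_noncrossing: "noncrossing E"
  using triangulation by (auto simp: triangulation_def)

lemma edge_bounds:
  assumes "{x, y} \<in> E"
  shows "1 \<le> x" "x \<le> s" "1 \<le> y" "y \<le> s" "x \<noteq> y"
proof -
  have "{x, y} \<in> chords s" using assms edge_chord by blast
  then obtain a b where "{x, y} = {a, b}" "a \<in> {1..s}" "b \<in> {1..s}" "a \<noteq> b"
    unfolding chords_def by blast
  then show "1 \<le> x" "x \<le> s" "1 \<le> y" "y \<le> s" "x \<noteq> y" by (auto simp: doubleton_eq_iff)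
qed

lemma edgeE:
  assumes "d \<in> E"
  obtains x y where "d = {x, y}" "x < y" "1 \<le> x" "y \<le> s"
proof -
  obtain x y where xy: "d = {x, y}" "x \<noteq> y" using assms edge_chord unfolding chords_def by blast
  then show ?thesis using that[of x y] that[of y x] edge_bounds[of x y] assms
    by (cases "x < y") (auto simp: insert_commute)
qed

lemma finite_edges: "finite E"
proof (rule finite_subset)
  show "E \<subseteq> Pow {1..s}" by (auto elim!: edgeE)
qed simp

lemma edge_nocross: "{p, r} \<in> E \<Longrightarrow> {q, t} \<in> E \<Longrightarrow> p < q \<Longrightarrow> q < r \<Longrightarrow> p \<le> t \<and> t \<le> r"
  using noncrossingD[OF edges_noncrossing] .

lemma edge_nocross_disj: "{p, r} \<in> E \<Longrightarrow> {q, t} \<in> E \<Longrightarrow> q \<le> p \<or> r \<le> q \<or> p \<le> t \<and> t \<le> r"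
  using edge_nocross[of p r q t] by linarith

text \<open>By maximality, a chord that crosses no edge is an edge. A crossing edge has an endpoint
  strictly between \<open>a\<close> and \<open>b\<close>, so it is enough to test the edges at such
  points.\<close>

lemma edgeI:
  assumes ab: "1 \<le> a" "a < b" "b \<le> s"
    and nocross: "\<And>x y. {x, y} \<in> E \<Longrightarrow> a < x \<Longrightarrow> x < b \<Longrightarrow> a \<le> y \<and> y \<le> b"
  shows "{a, b} \<in> E"
proof -
  have "noncrossing (insert {a, b} E)"
  proof (rule noncrossingI)
    fix p q r t
    assume pr: "{p, r} \<in> insert {a, b} E" and qt: "{q, t} \<in> insert {a, b} E"
      and less: "p < q" "q < r" "r < t"
    show False
    proof (cases "{p, r} = {a, b}")
      case True
      then have "p = a" "r = b" using ab less by (auto simp: doubleton_eq_iff)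
      moreover have "{q, t} \<in> E" using qt calculation less by (auto simp: doubleton_eq_iff)
      ultimately show False using nocross[of q t] less by auto
    next
      case False
      then have pr: "{p, r} \<in> E" using pr by simp
      show False
      proof (cases "{q, t} = {a, b}")
        case True
        then have "q = a" "t = b" using ab less by (auto simp: doubleton_eq_iff)
        then show False using nocross[of r p] pr less by (auto simp: insert_commute)
      next
        case False
        then show False using edge_nocross[OF pr, of q t] qt less by auto
      qed
    qed
  qed
  moreover have "insert {a, b} E \<subseteq> chords s"
    using edge_chord ab unfolding chords_def by fastforce
  ultimately have "insert {a, b} E = E" using triangulation unfolding triangulation_def by blast
  then show ?thesis by blast
qed

lemma side: "1 \<le> a \<Longrightarrow> a < s \<Longrightarrow> {a, Suc a} \<in> E"
  by (rule edgeI) auto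

lemma last_side: "2 \<le> s \<Longrightarrow> {1, s} \<in> E"
proof (rule edgeI)
  fix x y assume "{x, y} \<in> E"
  then show "1 \<le> y \<and> y \<le> s" using edge_bounds by blast
qed auto

text \<open>The apex is the largest neighbour of \<open>u\<close> below \<open>v\<close>. An edge
  crossing {w, v} would also cross {u, v} or {u, w}, or it would give \<open>u\<close> a larger
  neighbour.\<close>

lemma inner_triangle:
  assumes uv: "{u, v} \<in> E" "Suc u < v"
  shows "\<exists>w. u < w \<and> w < v \<and> {u, w} \<in> E \<and> {w, v} \<in> E"
proof -
  note b = edge_bounds[OF uv(1)]
  let ?N = "{w. u < w \<and> w < v \<and> {u, w} \<in> E}"
  define w where "w = Max ?N"
  have "Suc u \<in> ?N" using side[of u] uv b by auto
  then have "w \<in> ?N" unfolding w_def by (intro Max_in) auto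
  then have w: "u < w" "w < v" "{u, w} \<in> E" by auto
  have w_max: "x \<le> w" if "x \<in> ?N" for x unfolding w_def using that by (intro Max_ge) auto
  have "{w, v} \<in> E"
  proof (rule edgeI)
    show "1 \<le> w" "w < v" "v \<le> s" using w b by auto
    fix x y assume xy: "{x, y} \<in> E" "w < x" "x < v"
    have "u \<le> y \<and> y \<le> v" using edge_nocross[OF uv(1) xy(1)] w xy by auto
    moreover have "y \<noteq> u" using w_max[of x] xy w by (auto simp: insert_commute)
    moreover have "\<not> (u < y \<and> y < w)"
      using edge_nocross[of u w y x] w xy by (auto simp: insert_commute)
    ultimately show "w \<le> y \<and> y \<le> v" by auto
  qed
  then show ?thesis using w by blast
qed

text \<open>The apex is the first neighbour of \<open>u\<close> met after \<open>v\<close> in cyclic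
  order: the least one above \<open>v\<close>, or, if there is none, the least one below
  \<open>u\<close>.\<close>

lemma outer_triangle:
  assumes uv: "{u, v} \<in> E" "u < v" and not_last: "\<not> (u = 1 \<and> v = s)"
  shows "\<exists>w. (w < u \<or> v < w) \<and> {u, w} \<in> E \<and> {w, v} \<in> E"
proof -
  note b = edge_bounds[OF uv(1)]
  show ?thesis
  proof (cases "\<exists>w>v. {u, w} \<in> E")
    case True
    define w where "w = (LEAST w. v < w \<and> {u, w} \<in> E)"
    have w: "v < w" "{u, w} \<in> E" using LeastI_ex[of "\<lambda>w. v < w \<and> {u, w} \<in> E"] True
      unfolding w_def by auto
    have w_min: "w \<le> x" if "v < x" "{u, x} \<in> E" for x
      using that Least_le[of "\<lambda>w. v < w \<and> {u, w} \<in> E" x] unfolding w_def by auto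
    have "{v, w} \<in> E"
    proof (rule edgeI)
      show "1 \<le> v" "v < w" "w \<le> s" using w b edge_bounds[OF w(2)] by auto
      fix x y assume xy: "{x, y} \<in> E" "v < x" "x < w"
      have "u \<le> y \<and> y \<le> w" using edge_nocross[OF w(2) xy(1)] uv xy by auto
      moreover have "y \<noteq> u" using w_min[of x] xy by (auto simp: insert_commute)
      moreover have "\<not> (u < y \<and> y < v)"
        using edge_nocross[OF uv(1), of y x] xy by (auto simp: insert_commute)
      ultimately show "v \<le> y \<and> y \<le> w" by auto
    qed
    then show ?thesis using w by (intro exI[of _ w]) (auto simp: insert_commute)
  next
    case False
    \<comment> \<open>For \<open>u = 1\<close> the side {1, s} would supply a neighbour above
      \<open>v\<close>.\<close>
    have "u \<noteq> 1"
    proof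
      assume "u = 1"
      then show False using last_side False not_last b uv by auto
    qed
    then obtain u' where u': "u = Suc u'" "1 \<le> u'" using b by (cases u) auto
    define w where "w = (LEAST w. w < u \<and> {u, w} \<in> E)"
    have "u' < u \<and> {u, u'} \<in> E" using side[of u'] u' b by (auto simp: insert_commute)
    then have w: "w < u" "{u, w} \<in> E" using LeastI[of "\<lambda>w. w < u \<and> {u, w} \<in> E" u']
      unfolding w_def by auto
    have w_min: "w \<le> x" if "x < u" "{u, x} \<in> E" for x
      using that Least_le[of "\<lambda>w. w < u \<and> {u, w} \<in> E" x] unfolding w_def by auto
    have "{w, v} \<in> E"
    proof (rule edgeI)
      show "1 \<le> w" "w < v" "v \<le> s" using w b edge_bounds[OF w(2)] uv by auto
      fix x y assume xy: "{x, y} \<in> E" "w < x" "x < v"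
      consider "x < u" | "x = u" | "u < x" by linarith
      then show "w \<le> y \<and> y \<le> v"
      proof cases
        case 1
        then show ?thesis using edge_nocross[of w u x y] w xy uv by (auto simp: insert_commute)
      next
        case 2
        have "y \<le> v" using False xy 2 by (meson not_le)
        moreover have "w \<le> y" using w_min[of y] w xy 2 by (meson less_le_trans not_le less_imp_le)
        ultimately show ?thesis by simp
      next
        case 3
        then show ?thesis using edge_nocross[OF uv(1) xy(1)] w xy by auto
      qed
    qed
    then show ?thesis using w by blast
  qed
qed

lemma triangleE:
  assumes "t \<in> triangles \<tt>"
  obtains a b c where "t = {a, b, c}" "a < b" "b < c" "1 \<le> a" "c \<le> s"
    "{a, b} \<in> E" "{b, c} \<in> E" "{a, c} \<in> E"
proof -
  obtain a b c where t: "t = {a, b, c}" "a \<noteq> b" "b \<noteq> c" "a \<noteq> c"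
    "{a, b} \<in> E" "{b, c} \<in> E" "{a, c} \<in> E" using assms unfolding triangles_def by blast
  have t': "{b, a} \<in> E" "{c, b} \<in> E" "{c, a} \<in> E" using t by (auto simp: insert_commute)
  have b: "1 \<le> a" "a \<le> s" "1 \<le> b" "b \<le> s" "1 \<le> c" "c \<le> s"
    using edge_bounds[OF t(5)] edge_bounds[OF t(6)] by auto
  consider "a < b" "b < c" | "a < c" "c < b"
    | "b < a" "a < c" | "b < c" "c < a"
    | "c < a" "a < b" | "c < b" "b < a"
    using t by linarith
  then show ?thesis
  proof cases
    case 1
    then show ?thesis by (intro that[of a b c]) (use t t' b in auto)
  next
    case 2
    then show ?thesis by (intro that[of a c b]) (use t t' b in auto)
  next
    case 3
    then show ?thesis by (intro that[of b a c]) (use t t' b in auto)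
  next
    case 4
    then show ?thesis by (intro that[of b c a]) (use t t' b in auto)
  next
    case 5
    then show ?thesis by (intro that[of c a b]) (use t t' b in auto)
  next
    case 6
    then show ?thesis by (intro that[of c b a]) (use t t' b in auto)
  qed
qed

lemma triangleI:
  "{a, b} \<in> E \<Longrightarrow> {b, c} \<in> E \<Longrightarrow> {a, c} \<in> E \<Longrightarrow> {a, b, c} \<in> triangles \<tt>"
  unfolding triangles_def mem_Collect_eq
  by (intro exI[of _ a] exI[of _ b] exI[of _ c] conjI refl edge_bounds(5)) assumption+

lemma triangle_subset: "t \<in> triangles \<tt> \<Longrightarrow> t \<subseteq> {1..s}"
  by (erule triangleE) auto

lemma triangle_bounds: "t \<in> triangles \<tt> \<Longrightarrow> v \<in> t \<Longrightarrow> 1 \<le> v \<and> v \<le> s"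
  using triangle_subset[of t] by auto

lemma finite_triangle: "t \<in> triangles \<tt> \<Longrightarrow> finite t"
  using finite_subset[OF triangle_subset] by simp

lemma finite_triangles: "finite (triangles \<tt>)"
proof (rule finite_subset)
  show "triangles \<tt> \<subseteq> Pow {1..s}" using triangle_subset by blast
qed simp

section \<open>Triangles meeting a cyclic interval in at least two vertices\<close>

definition heavy :: "nat set \<Rightarrow> nat set set" where
  "heavy A = {t \<in> triangles \<tt>. 2 \<le> card (t \<inter> A)}"

lemma finite_heavy: "finite (heavy A)"
  using finite_triangles by (simp add: heavy_def)

text \<open>The triangle on \<open>u\<close>, \<open>v\<close>, \<open>w\<close> meets
  \<open>A\<close> only in \<open>u\<close>, but the enlarged set in \<open>u\<close> and
  \<open>v\<close>. It becomes heavy when \<open>v\<close> is added, and no heavy triangle is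
  lost.\<close>

lemma heavy_insert:
  assumes "v \<notin> A" "u \<in> A" "w \<notin> A" "{u, v} \<in> E" "{v, w} \<in> E" "{u, w} \<in> E"
  shows "Suc (card (heavy A)) \<le> card (heavy (insert v A))"
proof -
  have t: "{u, v, w} \<in> triangles \<tt>" using assms by (intro triangleI)
  have "{u, v, w} \<inter> A = {u}" "{u, v, w} \<inter> insert v A = {u, v}"
    using assms edge_bounds[OF assms(5)] by auto
  moreover have "u \<noteq> v" using edge_bounds[OF assms(4)] by simp
  ultimately have new: "{u, v, w} \<in> heavy (insert v A)" "{u, v, w} \<notin> heavy A"
    using t unfolding heavy_def by auto
  have "heavy A \<subseteq> heavy (insert v A)"
  proof
    fix t assume t: "t \<in> heavy A"
    have "card (t \<inter> A) \<le> card (t \<inter> insert v A)"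
      using finite_triangle t unfolding heavy_def by (intro card_mono) auto
    then show "t \<in> heavy (insert v A)" using t unfolding heavy_def by auto
  qed
  then have "insert {u, v, w} (heavy A) \<subseteq> heavy (insert v A)" using new by blast
  from card_mono[OF finite_heavy this] show ?thesis using new finite_heavy by simp
qed

text \<open>The interval grows to the right, and each new vertex makes at least one more triangle
  heavy.\<close>

lemma heavy_interval:
  assumes "1 \<le> a" "a \<le> b" "b \<le> s" "\<not> (a = 1 \<and> b = s)"
  shows "b - a \<le> card (heavy {a..b})"
  using assms(2-4)
proof (induction b rule: dec_induct)
  case (step m)
  let ?N = "\<lambda>x. a \<le> x \<and> x \<le> m \<and> {x, Suc m} \<in> E"
  \<comment> \<open>Choosing the least neighbour forces the apex of the outer triangle on {u, Suc m}
    out of {a..m}. This edge is not {1, s}, because the interval is proper.\<close>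
  define u where "u = (LEAST x. ?N x)"
  have "?N m" using side[of m] step assms(1) by auto
  then have u: "?N u" unfolding u_def by (rule LeastI)
  have u_min: "u \<le> x" if "?N x" for x unfolding u_def using that by (rule Least_le)
  obtain w where w: "w < u \<or> Suc m < w" "{u, w} \<in> E" "{w, Suc m} \<in> E"
    using outer_triangle[of u "Suc m"] u step assms(1) by auto
  have "w \<notin> {a..m}" using w u_min[of w] u by auto
  then have "Suc (card (heavy {a..m})) \<le> card (heavy (insert (Suc m) {a..m}))"
    using heavy_insert[of "Suc m" "{a..m}" u w] u w by (auto simp: insert_commute)
  moreover have "insert (Suc m) {a..m} = {a..Suc m}" using step by auto
  ultimately show ?case using step by auto
qed simp

text \<open>Starting with {1..b}, encoded as \<open>c = Suc s\<close>, the interval grows downwards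
  from \<open>s\<close>. The edge from the new vertex to its cyclically farthest neighbour in the
  present interval carries a triangle with apex in the gap.\<close>

lemma heavy_wrap:
  assumes b: "1 \<le> b" and "c \<le> Suc s" "b + 1 < c"
  shows "b + s - c \<le> card (heavy ({1..b} \<union> {c..s}))"
  using assms(2-3)
proof (induction c rule: inc_induct)
  case base
  have "{1..b} \<union> {Suc s..s} = {1..b}" by auto
  then show ?case using heavy_interval[of 1 b] base b by auto
next
  case (step c)
  let ?A = "{1..b} \<union> {Suc c..s}"
  have "\<exists>u w. u \<in> ?A \<and> b < w \<and> w < c \<and> {u, c} \<in> E \<and> {c, w} \<in> E \<and> {u, w} \<in> E"
  \<comment> \<open>Neighbours in {1..b} are farther than those above \<open>c\<close>: the largest
    of them is taken if there is one, and otherwise the largest neighbour above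
    \<open>c\<close>.\<close>
  proof (cases "\<exists>x. x \<le> b \<and> {x, c} \<in> E")
    case True
    let ?N = "{x. x \<le> b \<and> {x, c} \<in> E}"
    define u where "u = Max ?N"
    have "finite ?N" by (rule finite_subset[of _ "{..b}"]) auto
    then have "u \<in> ?N" unfolding u_def using True by (intro Max_in) auto
    then have u: "u \<le> b" "{u, c} \<in> E" by auto
    have u_max: "x \<le> u" if "x \<in> ?N" for x
      unfolding u_def using that \<open>finite ?N\<close> by (intro Max_ge)
    obtain w where w: "u < w" "w < c" "{u, w} \<in> E" "{w, c} \<in> E"
      using inner_triangle[of u c] u step by auto
    then have "b < w" using u_max[of w] by force
    moreover have "1 \<le> u" using edge_bounds[of u c] u by auto
    ultimately show ?thesis using u w
      by (intro exI[of _ u] exI[of _ w]) (auto simp: insert_commute)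
  next
    case False
    have "c < s"
    proof (rule ccontr)
      assume "\<not> c < s"
      then have "c = s" using step by auto
      then show False using False last_side b step by auto
    qed
    let ?N = "{x. c < x \<and> {c, x} \<in> E}"
    define z where "z = Max ?N"
    have "?N \<subseteq> {..s}" using edge_bounds by auto
    then have "finite ?N" by (rule finite_subset) simp
    have "Suc c \<in> ?N" using side[of c] \<open>c < s\<close> step by auto
    then have "z \<in> ?N" unfolding z_def using \<open>finite ?N\<close> by (intro Max_in) auto
    then have z: "c < z" "{c, z} \<in> E" by auto
    have z_max: "x \<le> z" if "x \<in> ?N" for x
      unfolding z_def using that \<open>finite ?N\<close> by (intro Max_ge)
    obtain w where w: "w < c \<or> z < w" "{c, w} \<in> E" "{w, z} \<in> E"
      using outer_triangle[of c z] z step by auto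
    have "\<not> z < w" using z_max[of w] w z by auto
    moreover have "b < w" using False w(2) by (metis insert_commute not_le)
    ultimately show ?thesis using w z edge_bounds[of c z]
      by (intro exI[of _ z] exI[of _ w]) (auto simp: insert_commute)
  qed
  then obtain u w where uw: "u \<in> ?A" "b < w" "w < c" "{u, c} \<in> E" "{c, w} \<in> E" "{u, w} \<in> E" by blast
  have "Suc (card (heavy ?A)) \<le> card (heavy (insert c ?A))"
    using heavy_insert[of c ?A u w] uw step by auto
  moreover have "insert c ?A = {1..b} \<union> {c..s}" using step by auto
  ultimately show ?case using step by auto
qed

text \<open>Nonempty and proper intervals only: for the whole polygon the bound of
  \<open>card_heavy\<close> would fail, as there are only \<open>s - 2\<close> triangles.\<close>

definition cyclic_interval :: "nat set \<Rightarrow> bool" where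
  "cyclic_interval A \<longleftrightarrow>
     (\<exists>a b. 1 \<le> a \<and> a \<le> b \<and> b \<le> s \<and> \<not> (a = 1 \<and> b = s) \<and> A = {a..b}) \<or>
     (\<exists>b c. 1 \<le> b \<and> b + 1 < c \<and> c \<le> s \<and> A = {1..b} \<union> {c..s})"

lemma card_heavy:
  assumes "cyclic_interval A"
  shows "card A \<le> Suc (card (heavy A))"
  using assms unfolding cyclic_interval_def
proof (elim disjE exE conjE)
  fix a b assume "1 \<le> a" "a \<le> b" "b \<le> s" "\<not> (a = 1 \<and> b = s)" "A = {a..b}"
  then show ?thesis using heavy_interval[of a b] by auto
next
  fix b c assume bc: "1 \<le> b" "b + 1 < c" "c \<le> s" "A = {1..b} \<union> {c..s}"
  then have "card A = b + (Suc s - c)" by (subst bc(4), subst card_Un_disjoint) auto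
  then show ?thesis using heavy_wrap[of b c] bc by auto
qed

lemma finite_cyclic_interval: "cyclic_interval A \<Longrightarrow> finite A"
  unfolding cyclic_interval_def by auto

text \<open>Pigeonhole: if \<open>f\<close> mapped all heavy triangles into \<open>A\<close>, then
  at least \<open>card A - 1\<close> of them would inject into \<open>A - {a, b}\<close>.\<close>

lemma matching_escapes:
  assumes A: "cyclic_interval A" and ab: "a \<in> A" "b \<in> A" "a \<noteq> b"
    and f: "inj_on f (triangles \<tt>)" "\<And>t. t \<in> triangles \<tt> \<Longrightarrow> f t \<in> t - {a, b}"
  shows "\<exists>t \<in> heavy A. f t \<in> t - A"
proof (rule ccontr)
  assume contr: "\<not> ?thesis"
  have sub: "heavy A \<subseteq> triangles \<tt>" by (auto simp: heavy_def)
  have "f ` heavy A \<subseteq> A - {a, b}" using contr f(2) sub by blast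
  then have "card (f ` heavy A) \<le> card (A - {a, b})"
    using finite_cyclic_interval[OF A] by (intro card_mono) auto
  also have "card (f ` heavy A) = card (heavy A)"
    using f(1) sub by (meson card_image inj_on_subset)
  also have "card (A - {a, b}) = card A - 2" using ab finite_cyclic_interval[OF A]
    by (simp add: card_Diff_subset)
  finally have "card (heavy A) \<le> card A - 2" .
  moreover have "2 \<le> card A"
    using card_mono[of A "{a, b}"] ab finite_cyclic_interval[OF A] by auto
  ultimately show False using card_heavy[OF A] by linarith
qed


section \<open>Far sides of a triangle\<close>

lemma far_side_sorted:
  assumes "a < b" "b < c"
  shows "far_side s {a, b, c} a = {b..c}" "far_side s {a, b, c} b = {1..a} \<union> {c..s}"
    "far_side s {a, b, c} c = {a..b}"
proof -
  have "{a, b, c} - {a} = {b, c}" "{a, b, c} - {b} = {a, c}" "{a, b, c} - {c} = {a, b}"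
    using assms by auto
  then show "far_side s {a, b, c} a = {b..c}" "far_side s {a, b, c} b = {1..a} \<union> {c..s}"
    "far_side s {a, b, c} c = {a..b}"
    using assms unfolding far_side_def Let_def by auto
qed

text \<open>The far side wraps around when \<open>e\<close> is the middle vertex of the triangle in
  the linear order.\<close>

lemma far_side_cases:
  assumes "t \<in> triangles \<tt>" "e \<in> t"
  obtains (inner) v v' where "t = {e, v, v'}" "v < v'" "{v, v'} \<in> E" "{e, v} \<in> E" "{e, v'} \<in> E"
      "e < v \<or> v' < e" "far_side s t e = {v..v'}"
    | (wrap) v v' where "t = {e, v, v'}" "v < v'" "{v, v'} \<in> E" "{e, v} \<in> E" "{e, v'} \<in> E"
      "v < e" "e < v'" "far_side s t e = {1..v} \<union> {v'..s}"
proof -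
  obtain a b c where t: "t = {a, b, c}" "a < b" "b < c" "1 \<le> a" "c \<le> s" and
    E: "{a, b} \<in> E" "{b, c} \<in> E" "{a, c} \<in> E" using triangleE[OF assms(1)] .
  have E': "{b, a} \<in> E" "{c, b} \<in> E" "{c, a} \<in> E" using E by (simp_all add: insert_commute)
  note far = far_side_sorted[OF t(2,3), folded t(1)]
  consider "e = a" | "e = b" | "e = c" using assms(2) t(1) by blast
  then show ?thesis
  proof cases
    case 1
    show ?thesis by (rule inner[of b c]) (use 1 t(1-3) E E' far in simp_all)
  next
    case 2
    have "t = {b, a, c}" using t(1) by blast
    then show ?thesis by (intro wrap[of a c]) (use 2 t(2,3) E E' far in simp_all)
  next
    case 3
    have "t = {c, a, b}" using t(1) by blast
    then show ?thesis by (intro inner[of a b]) (use 3 t(2,3) E E' far in simp_all)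
  qed
qed

lemma cyclic_interval_far_side:
  assumes t: "t \<in> triangles \<tt>" "e \<in> t"
  shows "cyclic_interval (far_side s t e)"
  using t
proof (cases rule: far_side_cases)
  case (inner v v')
  have "1 \<le> e" "e \<le> s" using triangle_bounds[OF t] by auto
  then show ?thesis unfolding cyclic_interval_def using inner edge_bounds[OF inner(3)]
    by (intro disjI1 exI[of _ v] exI[of _ v']) auto
next
  case (wrap v v')
  then show ?thesis unfolding cyclic_interval_def using edge_bounds[OF wrap(3)]
    by (intro disjI2 exI[of _ v] exI[of _ v']) auto
qed

text \<open>As \<open>t\<close> has two vertices in \<open>A\<close> and \<open>e\<close> lies
  outside, both other vertices are in \<open>A\<close>. A cyclic interval containing them and
  missing \<open>e\<close> contains the whole stretch between them away from
  \<open>e\<close>.\<close>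

lemma far_side_subset:
  assumes A: "cyclic_interval A" and t: "t \<in> heavy A" and e: "e \<in> t - A"
  shows "far_side s t e \<subseteq> A"
proof -
  have T: "t \<in> triangles \<tt>" "e \<in> t" and c: "2 \<le> card (t \<inter> A)" using t e by (auto simp: heavy_def)
  have vs: "v \<in> A \<and> v' \<in> A" if "t = {e, v, v'}" for v v'
  proof (rule ccontr)
    assume "\<not> ?thesis"
    then have "t \<inter> A \<subseteq> {v} \<or> t \<inter> A \<subseteq> {v'}" using that e by auto
    then show False using c card_mono[of "{v}" "t \<inter> A"] card_mono[of "{v'}" "t \<inter> A"] by auto
  qed
  have e_s: "1 \<le> e" "e \<le> s" using triangle_bounds[OF T] by auto
  from T show ?thesis
  proof (cases rule: far_side_cases)
    case (inner v v')
    then show ?thesis using vs[OF inner(1)] A e e_s unfolding cyclic_interval_def by auto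
  next
    case (wrap v v')
    then show ?thesis using vs[OF wrap(1)] A e e_s unfolding cyclic_interval_def by auto
  qed
qed

text \<open>Two distinct apexes on the same side of {v, v'} would have crossing edges to
  \<open>v\<close> and \<open>v'\<close>.\<close>

lemma apex_unique:
  assumes "v < v'" "{e, v} \<in> E" "{e, v'} \<in> E" "{e', v} \<in> E" "{e', v'} \<in> E"
    and "e < v \<or> v' < e" "e' < v \<or> v' < e'"
  shows "e = e'"
proof -
  have False if "x < y" "x < v \<or> v' < x" "y < v \<or> v' < y"
    "{x, v} \<in> E" "{x, v'} \<in> E" "{y, v} \<in> E" "{y, v'} \<in> E" for x y
    using that(1-3) assms(1) edge_nocross[of x v y v'] edge_nocross[of v x v' y]
      edge_nocross[of x v' v y] that(4-7) by (auto simp: insert_commute)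
  from this[of e e'] this[of e' e] assms show ?thesis by (cases e e' rule: linorder_cases) auto
qed

text \<open>Unless \<open>t'\<close> has the side of \<open>t\<close> opposite \<open>e\<close> as
  its own side, one of its edges would cross that side. On the side of \<open>e\<close>, this edge
  bounds only one triangle.\<close>

lemma triangle_across:
  assumes t: "t \<in> triangles \<tt>" "e \<in> t" and t': "t' \<in> heavy (far_side s t e)" "e' \<in> t' - far_side s t e"
  shows "t' = t \<and> e' = e"
proof -
  have T': "t' \<in> triangles \<tt>" "e' \<in> t'" and c: "2 \<le> card (t' \<inter> far_side s t e)"
    using t' by (auto simp: heavy_def)
  obtain u u' where u: "t' = {e', u, u'}" "u < u'" and E': "{u, u'} \<in> E" "{e', u} \<in> E" "{e', u'} \<in> E"
    using T' by (cases rule: far_side_cases) blast+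
  have u_in: "u \<in> far_side s t e" "u' \<in> far_side s t e"
  proof -
    have "t' \<inter> far_side s t e \<subseteq> {u, u'}" using u t' by auto
    moreover have "card {u, u'} = 2" using u by simp
    ultimately have "t' \<inter> far_side s t e = {u, u'}" using c by (intro card_seteq) auto
    then show "u \<in> far_side s t e" "u' \<in> far_side s t e" by auto
  qed
  have bounds: "1 \<le> e'" "e' \<le> s" using triangle_bounds[OF T'] by auto
  from t show ?thesis
  proof (cases rule: far_side_cases)
    case (inner v v')
    then have e': "e' < v \<or> v' < e'" using t' by auto
    have u_b: "v \<le> u" "u' \<le> v'" using u_in u inner by auto
    have "u = v"
      using edge_nocross_disj[OF inner(3), of u e'] E' u_b u e' by (auto simp: insert_commute)
    moreover have "u' = v'"
      using edge_nocross_disj[OF inner(3), of u' e'] E' u_b u e' by (auto simp: insert_commute)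
    moreover have "e' = e"
      using apex_unique[of v v' e' e] e' inner E' \<open>u = v\<close> \<open>u' = v'\<close> by blast
    ultimately show ?thesis using u inner by simp
  next
    case (wrap v v')
    then have e': "v < e'" "e' < v'" using t' bounds by auto
    have u_v: "u \<in> {v, v'}" "u' \<in> {v, v'}"
      using edge_nocross_disj[OF wrap(3), of e' u] edge_nocross_disj[OF wrap(3), of e' u'] E' e' u_in wrap
      by auto
    then have "u = v" "u' = v'" using u wrap by auto
    moreover have "e' = e"
    proof (rule ccontr)
      assume "e' \<noteq> e"
      note cross = edge_nocross_disj[of v e' e v'] edge_nocross_disj[of v e e' v']
      show False using \<open>e' \<noteq> e\<close> e' wrap E' cross \<open>u = v\<close> \<open>u' = v'\<close> by (auto simp: insert_commute)
    qed
    ultimately show ?thesis using u wrap by simp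
  qed
qed

text \<open>An edge crosses no side of \<open>t\<close>, so it lies within one of the three far
  sides. This makes the multiplicities at \<open>t\<close> add up to at least the number of
  arcs.\<close>

lemma far_sides_cover:
  assumes t: "t \<in> triangles \<tt>" and d: "d \<in> E"
  shows "\<exists>a\<in>t. d \<subseteq> far_side s t a"
proof -
  obtain a b c where abc: "t = {a, b, c}" "a < b" "b < c" and
    E: "{a, b} \<in> E" "{b, c} \<in> E" "{a, c} \<in> E" using triangleE[OF t] .
  note far = far_side_sorted[OF abc(2,3), folded abc(1)]
  obtain x y where xy: "d = {x, y}" "x < y" "1 \<le> x" "y \<le> s" using edgeE[OF d] .
  have xyE: "{x, y} \<in> E" "{y, x} \<in> E" using d xy by (simp_all add: insert_commute)
  have "d \<subseteq> far_side s t a \<or> d \<subseteq> far_side s t b \<or> d \<subseteq> far_side s t c"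
    unfolding far xy(1)
    using edge_nocross_disj[OF E(1) xyE(1)] edge_nocross_disj[OF E(1) xyE(2)]
      edge_nocross_disj[OF E(2) xyE(1)] edge_nocross_disj[OF E(2) xyE(2)]
      edge_nocross_disj[OF E(3) xyE(1)] edge_nocross_disj[OF E(3) xyE(2)] xy abc(2,3) by auto
  then show ?thesis using abc(1) by blast
qed

text \<open>Two far sides of one triangle share a single vertex, whereas an edge has two. This keeps
  the labels at a black vertex disjoint.\<close>

lemma far_sides_disjoint:
  assumes t: "t \<in> triangles \<tt>" and d: "d \<in> E"
    and a: "a \<in> t" "b \<in> t" "d \<subseteq> far_side s t a" "d \<subseteq> far_side s t b"
  shows "a = b"
proof -
  obtain p q r where abc: "t = {p, q, r}" "p < q" "q < r" using triangleE[OF t] by blast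
  note far = far_side_sorted[OF abc(2,3), folded abc(1)]
  obtain x y where xy: "d = {x, y}" "x < y" "1 \<le> x" "y \<le> s" using edgeE[OF d] .
  show ?thesis using a abc far xy by auto
qed

text \<open>The triangles at \<open>v\<close> form a fan, and their far sides opposite
  \<open>v\<close> overlap at most in single vertices. This keeps the labels at a white vertex
  disjoint.\<close>

lemma common_far_side:
  assumes t: "t \<in> triangles \<tt>" "v \<in> t" "t' \<in> triangles \<tt>" "v \<in> t'" and d: "d \<in> E"
    and far: "d \<subseteq> far_side s t v" "d \<subseteq> far_side s t' v"
  shows "t = t'"
proof -
  obtain x y where xy: "d = {x, y}" "x < y" "1 \<le> x" "y \<le> s" using edgeE[OF d] .
  show ?thesis
    using t(1,2)
  proof (cases rule: far_side_cases)
    case 1: (inner a b)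
    from t(3,4) show ?thesis
    proof (cases rule: far_side_cases)
      case 2: (inner a' b')
      note cross = edge_nocross_disj[OF 1(3), of a' v] edge_nocross_disj[OF 1(3), of b' v]
        edge_nocross_disj[OF 2(3), of a v] edge_nocross_disj[OF 2(3), of b v]
      have "a = a' \<and> b = b'" using cross 1 2 far xy by (auto simp: insert_commute)
      then show ?thesis using 1 2 by simp
    next
      case 2: (wrap a' b')
      show ?thesis using 1 2 far xy edge_nocross_disj[OF 2(3), of v a] edge_nocross_disj[OF 2(3), of v b] by auto
    qed
  next
    case 1: (wrap a b)
    from t(3,4) show ?thesis
    proof (cases rule: far_side_cases)
      case 2: (inner a' b')
      show ?thesis using 1 2 far xy edge_nocross_disj[OF 1(3), of v a'] edge_nocross_disj[OF 1(3), of v b'] by auto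
    next
      case 2: (wrap a' b')
      note cross = edge_nocross_disj[OF 1(3), of v a'] edge_nocross_disj[OF 1(3), of v b']
        edge_nocross_disj[OF 2(3), of v a] edge_nocross_disj[OF 2(3), of v b]
      have "a = a' \<and> b = b'" using cross 1 2 far xy by (auto simp: insert_commute)
      then show ?thesis using 1 2 by simp
    qed
  qed
qed

end

section \<open>Colours of positions\<close>

text \<open>Translates the sorted list of short arcs behind \<open>color_set\<close> into counting,
  so that colours become functions of \<open>cuts_before\<close>.\<close>

lemma nth_sorted_list_of_set_less_iff:
  fixes S :: "nat set"
  assumes S: "finite S" and j: "1 \<le> j" "j \<le> card S"
  shows "sorted_list_of_set S ! (j - 1) < i \<longleftrightarrow> j \<le> card {h \<in> S. h < i}"
proof -
  define xs where "xs = sorted_list_of_set S"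
  have xs: "set xs = S" "distinct xs" "sorted xs" "length xs = card S"
    using S by (auto simp: xs_def)
  have less: "xs ! a < xs ! b" if "a < b" "b < card S" for a b
  proof -
    have "xs ! a \<le> xs ! b" using sorted_nth_mono[OF xs(3), of a b] that xs(4) by simp
    moreover have "xs ! a \<noteq> xs ! b" using nth_eq_iff_index_eq[OF xs(2), of a b] that xs(4) by simp
    ultimately show ?thesis by simp
  qed
  have img: "{h \<in> S. h < i} = (!) xs ` {m. m < card S \<and> xs ! m < i}" (is "_ = _ ` ?I")
    using xs(1,4) by (auto simp: in_set_conv_nth)
  have "inj_on ((!) xs) ?I" using xs(2,4) by (auto simp: inj_on_def nth_eq_iff_index_eq)
  then have card: "card {h \<in> S. h < i} = card ?I" using img by (simp add: card_image)
  have fin: "finite ?I" by simp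
  have j': "j - 1 < card S" using j by simp
  show ?thesis
  proof
    assume lt: "sorted_list_of_set S ! (j - 1) < i"
    have "{..<j} \<subseteq> ?I"
    proof
      fix m assume "m \<in> {..<j}"
      then have "m = j - 1 \<or> m < j - 1" by auto
      then show "m \<in> ?I" using lt less[OF _ j', of m] j' unfolding xs_def[symmetric] by fastforce
    qed
    then show "j \<le> card {h \<in> S. h < i}" using card_mono[OF fin, of "{..<j}"] card by simp
  next
    assume le: "j \<le> card {h \<in> S. h < i}"
    show "sorted_list_of_set S ! (j - 1) < i"
    proof (rule ccontr)
      assume ge: "\<not> ?thesis"
      have "?I \<subseteq> {..<j - 1}"
      proof
        fix m assume m: "m \<in> ?I"
        show "m \<in> {..<j - 1}"
        proof (rule ccontr)
          assume "m \<notin> {..<j - 1}"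
          then have "m = j - 1 \<or> j - 1 < m" by auto
          then show False using ge m less[of "j - 1" m] unfolding xs_def[symmetric] by fastforce
        qed
      qed
      then have "card ?I \<le> j - 1" using card_mono[of "{..<j - 1}" ?I] by simp
      then show False using le card j by simp
    qed
  qed
qed

section \<open>Cut counts and colour classes\<close>

context noncrossing_matching
begin

abbreviation num_colours :: nat where "num_colours \<equiv> num_short_arcs n M"

text \<open>The cut given by \<open>h\<close> lies just after \<open>h\<close>, so it precedes
  \<open>i\<close> when \<open>h < i\<close>.\<close>

definition cuts_before :: "nat \<Rightarrow> nat" where
  "cuts_before i = card {h \<in> short_arc_starts n M. h < i}"

text \<open>The last colour class wraps around and contains the positions before the first cut,
  hence the default \<open>num_colours\<close>.\<close>

definition colour :: "nat \<Rightarrow> nat" where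
  "colour i = (if cuts_before i = 0 then num_colours else cuts_before i)"

lemma finite_starts: "finite (short_arc_starts n M)"
  by (simp add: short_arc_starts_def)

lemma cuts_before_mono: "i \<le> j \<Longrightarrow> cuts_before i \<le> cuts_before j"
  unfolding cuts_before_def using finite_starts by (intro card_mono) auto

lemma cuts_before_le: "cuts_before i \<le> num_colours"
  unfolding cuts_before_def num_short_arcs_def using finite_starts by (intro card_mono) auto

lemma cuts_before_less:
  assumes "h \<in> short_arc_starts n M" "i \<le> h" "h < j"
  shows "cuts_before i < cuts_before j"
  unfolding cuts_before_def
proof (rule psubset_card_mono[OF _ psubsetI])
  show "finite {h \<in> short_arc_starts n M. h < j}" using finite_starts by simp
  show "{h \<in> short_arc_starts n M. h < i} \<subseteq> {h \<in> short_arc_starts n M. h < j}" using assms by auto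
  have "h \<notin> {h \<in> short_arc_starts n M. h < i}" "h \<in> {h \<in> short_arc_starts n M. h < j}"
    using assms by simp_all
  then show "{h \<in> short_arc_starts n M. h < i} \<noteq> {h \<in> short_arc_starts n M. h < j}" by blast
qed

lemma short_arc_start:
  assumes "{i, i + 1} \<in> M"
  shows "i \<in> short_arc_starts n M"
  using arc_bounds[OF assms] assms by (simp add: short_arc_starts_def)

lemma cuts_before_arc:
  assumes "{p, q} \<in> M" "p < q"
  shows "cuts_before p < cuts_before q"
proof -
  obtain i where "p \<le> i" "i < q" "{i, i + 1} \<in> M" using short_arc_inside[OF assms] by blast
  then show ?thesis using cuts_before_less[OF short_arc_start, of i p q] by simp
qed

lemma num_colours_pos:
  assumes "1 \<le> n"
  shows "1 \<le> num_colours"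
proof -
  obtain j where j: "{1, j} \<in> M" "j \<noteq> 1" using partner[of 1] assms by auto
  then have "1 < j" using arc_bounds[OF j(1)] by auto
  from cuts_before_arc[OF j(1) this] cuts_before_le[of j] show ?thesis by simp
qed

lemma colour_bounds:
  assumes "1 \<le> n"
  shows "colour i \<in> {1..num_colours}"
  using num_colours_pos[OF assms] cuts_before_le[of i] by (auto simp: colour_def)

lemma color_set_subset:
  assumes "j \<in> {1..num_colours}"
  shows "color_set n M j \<subseteq> {1..n}"
proof -
  have "short_arc_start n M i \<in> {1..n}" if "i \<in> {1..num_colours}" for i
  proof -
    have "short_arc_start n M i \<in> set (sorted_list_of_set (short_arc_starts n M))"
      unfolding short_arc_start_def using that by (intro nth_mem) (auto simp: num_short_arcs_def)
    then show ?thesis using finite_starts by (simp add: short_arc_starts_def)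
  qed
  from this[of j] this[of "j + 1"] this[of 1] show ?thesis using assms
    unfolding color_set_def by auto
qed

lemma color_set_iff:
  assumes i: "i \<in> {1..n}" and j: "j \<in> {1..num_colours}"
  shows "i \<in> color_set n M j \<longleftrightarrow> colour i = j"
proof -
  have less: "short_arc_start n M m < i \<longleftrightarrow> m \<le> cuts_before i" if "m \<in> {1..num_colours}" for m
    using nth_sorted_list_of_set_less_iff[OF finite_starts, of m i] that
    unfolding short_arc_start_def cuts_before_def num_short_arcs_def by auto
  show ?thesis
  proof (cases "j < num_colours")
    case True
    then have "i \<in> color_set n M j \<longleftrightarrow> short_arc_start n M j < i \<and> \<not> short_arc_start n M (j + 1) < i"
      unfolding color_set_def by auto
    also have "\<dots> \<longleftrightarrow> j \<le> cuts_before i \<and> \<not> j + 1 \<le> cuts_before i"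
      using less[of j] less[of "j + 1"] True j by auto
    finally show ?thesis using True j by (auto simp: colour_def)
  next
    case False
    then have "j = num_colours" using j by simp
    then have "i \<in> color_set n M j \<longleftrightarrow>
        short_arc_start n M num_colours < i \<or> \<not> short_arc_start n M 1 < i"
      unfolding color_set_def using i by auto
    also have "\<dots> \<longleftrightarrow> num_colours \<le> cuts_before i \<or> \<not> 1 \<le> cuts_before i"
      using less[of num_colours] less[of 1] j by auto
    finally show ?thesis using \<open>j = num_colours\<close> cuts_before_le[of i] by (auto simp: colour_def)
  qed
qed

text \<open>An arc \<open>{p, q}\<close> could only be monochromatic if no cut separated its endpoints on one of the
  two sides, but an innermost arc on that side is a short arc and provides a cut.\<close>

lemma colour_arc_neq_less:
  assumes pq: "{p, q} \<in> M" "p < q"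
  shows "colour p \<noteq> colour q"
proof
  assume eq: "colour p = colour q"
  have "cuts_before p < cuts_before q" using cuts_before_arc[OF pq] .
  \<comment> \<open>Equal colours with different counts are only possible across the wrap, so every
    cut lies between \<open>p\<close> and \<open>q\<close>.\<close>
  then have p0: "cuts_before p = 0" and qs: "cuts_before q = num_colours"
    using eq by (auto simp: colour_def split: if_splits)
  have starts: "p \<le> h \<and> h < q" if "h \<in> short_arc_starts n M" for h
  proof -
    have "\<not> h < p" using cuts_before_less[OF that, of 0 p] p0 by auto
    moreover have "\<not> q \<le> h"
      using cuts_before_less[OF that, of q "h + 1"] qs cuts_before_le[of "h + 1"] by auto
    ultimately show ?thesis by simp
  qed
  have n: "1 \<le> p" "q \<le> n" using arc_bounds[OF pq(1)] by auto
  \<comment> \<open>The partner \<open>t\<close> of 1 must be \<open>n\<close>, since an arc lying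
    before \<open>p\<close> or after \<open>q\<close> would contain a cut outside the stretch. But
    then {n, 1} is a short arc whose start \<open>n\<close> is not below \<open>q\<close>.\<close>
  obtain t where t: "{1, t} \<in> M" "t \<noteq> 1" using partner[of 1] n pq by auto
  have t_n: "1 < t" "t \<le> n" using arc_bounds[OF t(1)] by auto
  have "q \<le> t"
  proof (rule ccontr)
    assume "\<not> q \<le> t"
    then have "t < q" by simp
    have "p \<noteq> 1" using arc_unique[of 1 t q] t pq \<open>t < q\<close> by auto
    then have "t < p" using nested[OF t(1) pq(1)] \<open>t < q\<close> n
        arc_unique[of p 1 q] t pq by (cases t p rule: linorder_cases) (auto simp: insert_commute)
    then show False using short_arc_inside[OF t(1)] t_n starts short_arc_start by fastforce
  qed
  have "t = n"
  proof (rule ccontr)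
    assume "t \<noteq> n"
    obtain u where u: "{n, u} \<in> M" "u \<noteq> n" using partner[of n] n pq by auto
    have un: "{u, n} \<in> M" "u < n" using u arc_bounds[OF u(1)] by (auto simp: insert_commute)
    have "u \<noteq> 1" "u \<noteq> t"
      using arc_unique[of 1 t n] arc_unique[of t 1 n] t un \<open>t \<noteq> n\<close> t_n by (auto simp: insert_commute)
    moreover have "\<not> u < t" using nested[OF t(1) un(1)] t_n calculation arc_bounds[OF un(1)] by auto
    ultimately have "q \<le> u" using \<open>q \<le> t\<close> by simp
    then show False using short_arc_inside[OF un] starts short_arc_start by fastforce
  qed
  then have "n \<in> short_arc_starts n M" using t t_n unfolding short_arc_starts_def
    by (simp add: insert_commute)
  then show False using starts[of n] n by simp
qed

lemma colour_arc_neq: "{p, q} \<in> M \<Longrightarrow> colour p \<noteq> colour q"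
  using colour_arc_neq_less[of p q] colour_arc_neq_less[of q p] arc_bounds(3)[of p q]
  by (cases p q rule: linorder_cases) (auto simp: insert_commute)

lemma colour_arc_chord:
  assumes "e \<in> M"
  shows "colour ` e \<in> chords num_colours"
proof -
  obtain p q where e: "e = {p, q}" using arcE[OF assms] by blast
  have "1 \<le> n" using arc_bounds[of p q] assms e by auto
  then show ?thesis using e colour_arc_neq[of p q] assms colour_bounds[of p] colour_bounds[of q]
    unfolding chords_def by blast
qed

lemma num_arcs_between_eq:
  assumes d: "d \<in> chords num_colours"
  shows "num_arcs_between n M d = card {e \<in> M. colour ` e = d}"
proof -
  have "(\<exists>a b x y. d = {a, b} \<and> e = {x, y} \<and> x \<in> color_set n M a \<and> y \<in> color_set n M b) \<longleftrightarrow>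
      colour ` e = d" if e: "e \<in> M" for e
  proof
    assume "\<exists>a b x y. d = {a, b} \<and> e = {x, y} \<and> x \<in> color_set n M a \<and> y \<in> color_set n M b"
    then obtain a b x y where *: "d = {a, b}" "e = {x, y}" "x \<in> color_set n M a" "y \<in> color_set n M b"
      by blast
    have "a \<in> {1..num_colours}" "b \<in> {1..num_colours}"
      using d * unfolding chords_def by (auto simp: doubleton_eq_iff)
    moreover have "x \<in> {1..n}" "y \<in> {1..n}" using arc_bounds[of x y] e * by auto
    ultimately show "colour ` e = d" using * color_set_iff by auto
  next
    assume eq: "colour ` e = d"
    obtain x y where xy: "e = {x, y}" using arcE[OF e] by blast
    have b: "x \<in> {1..n}" "y \<in> {1..n}" using arc_bounds[of x y] e xy by auto
    then have "1 \<le> n" by auto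
    then have "x \<in> color_set n M (colour x)" "y \<in> color_set n M (colour y)"
      using b color_set_iff colour_bounds by blast+
    moreover have "d = {colour x, colour y}" using eq xy by auto
    ultimately show "\<exists>a b x y. d = {a, b} \<and> e = {x, y} \<and> x \<in> color_set n M a \<and> y \<in> color_set n M b"
      using xy by blast
  qed
  then have "{e \<in> M. \<exists>a b x y. d = {a, b} \<and> e = {x, y} \<and> x \<in> color_set n M a \<and> y \<in> color_set n M b} =
    {e \<in> M. colour ` e = d}" by blast
  then show ?thesis unfolding num_arcs_between_def by simp
qed

section \<open>Arcs with the colours of two given positions\<close>

lemma colour_eq: "cuts_before i = cuts_before j \<Longrightarrow> colour i = colour j"
  by (simp add: colour_def)

text \<open>No cut separates \<open>g\<close> from \<open>p\<close> or \<open>q\<close> from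
  \<open>h\<close>, and no arc is monochromatic. The arcs at \<open>p\<close> and \<open>q\<close>,
  confined by {g, h} and leaving the stretch from \<open>p\<close> to \<open>q\<close>, therefore go
  to opposite ends: \<open>p'\<close> beyond \<open>q\<close> and \<open>q'\<close> before
  \<open>p\<close>. Such arcs cross.\<close>

lemma no_parallel_arc:
  assumes p: "{p, p'} \<in> M" and q: "{q, q'} \<in> M" and gh: "{g, h} \<in> M"
    and less: "p < q" "g \<le> p" "q \<le> h"
    and p': "p' < p \<or> q < p'" and q': "q' < p \<or> q < q'"
    and cuts: "cuts_before g = cuts_before p" "cuts_before h = cuts_before q"
  shows False
proof -
  have "g \<le> p' \<and> p' \<le> h"
    using nested[OF gh p] arc_unique[OF p, of h] gh less by (cases "g = p") auto
  moreover have "\<not> p' < p"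
  proof
    assume "p' < p"
    then have "cuts_before p' = cuts_before p"
      using cuts_before_mono[of g p'] cuts_before_mono[of p' p] calculation cuts by simp
    then show False using colour_arc_neq[OF p] colour_eq by metis
  qed
  ultimately have "q < p'" using p' by simp
  have "g \<le> q' \<and> q' \<le> h"
    using nested[OF gh q] arc_unique[OF q, of g] gh less
    by (cases "h = q") (auto simp: insert_commute)
  moreover have "\<not> q < q'"
  proof
    assume "q < q'"
    then have "cuts_before q' = cuts_before q"
      using cuts_before_mono[of q q'] cuts_before_mono[of q' h] calculation cuts by simp
    then show False using colour_arc_neq[OF q] colour_eq by metis
  qed
  ultimately have "q' < p" using q' by simp
  then show False using nested[of q' q p p'] p q less \<open>q < p'\<close> by (simp add: insert_commute)
qed

text \<open>Cyclic form of \<open>no_parallel_arc\<close>: the arc {g, h} would run around {p, q}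
  with no cut in between, leaving no place for the partners of \<open>p\<close> and
  \<open>q\<close>.\<close>

lemma no_equicoloured_outer_arc:
  assumes pq: "p < q" "p \<in> {1..n}" "q \<in> {1..n}" "{p, q} \<notin> M" "colour p \<noteq> colour q"
    and inner: "\<And>u v. p < u \<Longrightarrow> u < q \<Longrightarrow> {u, v} \<in> M \<Longrightarrow> p < v \<and> v < q"
    and gh: "{g, h} \<in> M" "\<not> (p < g \<and> g < q)" "colour g = colour p" "colour h = colour q"
  shows False
proof -
  obtain p' where p: "{p, p'} \<in> M" "p' \<noteq> p" using partner[OF pq(2)] by blast
  obtain q' where q: "{q, q'} \<in> M" "q' \<noteq> q" using partner[OF pq(3)] by blast
  have p': "p' < p \<or> q < p'"
  proof -
    have "\<not> (p < p' \<and> p' < q)" using inner[of p' p] p(1) by (auto simp: insert_commute)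
    moreover have "p' \<noteq> q" using p(1) pq(4) by auto
    ultimately show ?thesis using p(2) by auto
  qed
  have q': "q' < p \<or> q < q'"
  proof -
    have "\<not> (p < q' \<and> q' < q)" using inner[of q' q] q(1) by (auto simp: insert_commute)
    moreover have "q' \<noteq> p" using q(1) pq(4) by (auto simp: insert_commute)
    ultimately show ?thesis using q(2) by auto
  qed
  have h_outer: "\<not> (p < h \<and> h < q)" using inner[of h g] gh(1,2) by (auto simp: insert_commute)
  have le: "cuts_before p \<le> cuts_before q" using cuts_before_mono pq(1) by simp
  note mono = cuts_before_mono[of g p] cuts_before_mono[of q g] cuts_before_mono[of h p]
    cuts_before_mono[of q h]
  note bounds = cuts_before_le[of p] cuts_before_le[of q] cuts_before_le[of g] cuts_before_le[of h]
  \<comment> \<open>The cyclic order is g, p, q, h in all three cases. In \<open>left\<close> the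
    stretch from \<open>q\<close> to \<open>h\<close> passes from \<open>n\<close> to 1, and in
    \<open>right\<close> the stretch from \<open>g\<close> to \<open>p\<close> does.\<close>
  consider (around) "g \<le> p" "q \<le> h" "cuts_before g = cuts_before p" "cuts_before h = cuts_before q"
    | (left) "h < g" "g \<le> p" "cuts_before h = 0" "cuts_before g = cuts_before p"
      "cuts_before q = num_colours"
    | (right) "q \<le> h" "h < g" "cuts_before g = num_colours" "cuts_before h = cuts_before q"
      "cuts_before p = 0"
  proof (cases "cuts_before p = 0")
    case True
    then have q0: "cuts_before q \<noteq> 0" "cuts_before q < num_colours"
      using pq(5) bounds by (auto simp: colour_def split: if_splits)
    have h: "cuts_before h = cuts_before q" using gh(4) q0 by (auto simp: colour_def split: if_splits)
    have "q \<le> h" using h mono h_outer q0 True by (cases "q \<le> h") auto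
    have "cuts_before g = 0 \<or> cuts_before g = num_colours"
      using gh(3) True by (auto simp: colour_def split: if_splits)
    then show ?thesis
    proof
      assume "cuts_before g = 0"
      then show ?thesis using around h \<open>q \<le> h\<close> True mono q0 gh(2) by auto
    next
      assume g: "cuts_before g = num_colours"
      then have "h < g" using cuts_before_mono[of g h] h q0 by (cases "h < g") auto
      then show ?thesis using right g h \<open>q \<le> h\<close> True by auto
    qed
  next
    case False
    then have q0: "cuts_before p < cuts_before q" using le pq(5) by (auto simp: colour_def)
    have g: "cuts_before g = cuts_before p"
      using gh(3) False q0 bounds by (auto simp: colour_def split: if_splits)
    then have "g \<le> p" using mono gh(2) q0 by (cases "g \<le> p") auto
    have "cuts_before h = cuts_before q \<or> cuts_before h = 0 \<and> cuts_before q = num_colours"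
      using gh(4) False q0 by (auto simp: colour_def split: if_splits)
    then show ?thesis
    proof
      assume h: "cuts_before h = cuts_before q"
      then have "q \<le> h" using mono h_outer q0 by (cases "q \<le> h") auto
      then show ?thesis using around g h \<open>g \<le> p\<close> by auto
    next
      assume h: "cuts_before h = 0 \<and> cuts_before q = num_colours"
      then have "h < g" using cuts_before_mono[of g h] g False by (cases "h < g") auto
      then show ?thesis using left g h \<open>g \<le> p\<close> by auto
    qed
  qed
  then show False
  proof cases
    case around
    then show False using no_parallel_arc[OF p(1) q(1) gh(1) pq(1)] p' q' by blast
  next
    case left
    \<comment> \<open>The partner \<open>q'\<close> is forced between \<open>g\<close> and
      \<open>p\<close>, so {p, p'} is nested in {q', q}. Then \<open>p'\<close> also lies between
      \<open>g\<close> and \<open>p\<close> and has the colour of \<open>p\<close>.\<close>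
    have "\<not> q < q'"
    proof
      assume "q < q'"
      then have "cuts_before q' = cuts_before q"
        using cuts_before_mono[of q q'] cuts_before_le[of q'] left by simp
      then show False using colour_arc_neq[OF q(1)] colour_eq by metis
    qed
    then have "q' < p" using q' by simp
    have "h < q'"
    proof (rule ccontr)
      assume "\<not> h < q'"
      then have "cuts_before q' = 0" using cuts_before_mono[of q' h] left by simp
      then show False using colour_arc_neq[OF q(1)] left by (simp add: colour_def split: if_splits)
    qed
    moreover have "q' \<noteq> g"
      using arc_unique[of g h q] gh(1) q(1) left pq(1) by (auto simp: insert_commute)
    moreover have "\<not> q' < g"
      using nested[of h g q' q] gh(1) q(1) left pq(1) calculation by (auto simp: insert_commute)
    ultimately have "g < q'" by simp
    have "q' < p'" "p' < q" using nested[of q' q p p'] q(1) p(1) \<open>q' < p\<close> pq(1)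
      by (auto simp: insert_commute)
    then have "cuts_before p' = cuts_before p"
      using cuts_before_mono[of g p'] cuts_before_mono[of p' p] p' left \<open>g < q'\<close> by simp
    then show False using colour_arc_neq[OF p(1)] colour_eq by metis
  next
    case right
    \<comment> \<open>Mirror image: \<open>p'\<close> is forced between \<open>q\<close> and
      \<open>h\<close>, and then \<open>q'\<close> has the colour of \<open>q\<close>.\<close>
    have "\<not> p' < p"
    proof
      assume "p' < p"
      then have "cuts_before p' = cuts_before p" using cuts_before_mono[of p' p] right by simp
      then show False using colour_arc_neq[OF p(1)] colour_eq by metis
    qed
    then have "q < p'" using p' by simp
    have "p' < g"
    proof (rule ccontr)
      assume "\<not> p' < g"
      then have "cuts_before p' = num_colours"
        using cuts_before_mono[of g p'] cuts_before_le[of p'] right by simp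
      then show False using colour_arc_neq[OF p(1)] right by (simp add: colour_def split: if_splits)
    qed
    moreover have "p' \<noteq> h"
      using arc_unique[of h g p] gh(1) p(1) right pq(1) by (auto simp: insert_commute)
    moreover have "\<not> h < p'"
      using nested[of p p' h g] gh(1) p(1) right pq(1) calculation by (auto simp: insert_commute)
    ultimately have "p' < h" by simp
    have "p < q'" "q' < p'" using nested[OF p(1) q(1) pq(1) \<open>q < p'\<close>] by auto
    then have "cuts_before q' = cuts_before q"
      using cuts_before_mono[of q q'] cuts_before_mono[of q' h] q' right \<open>p' < h\<close> by simp
    then show False using colour_arc_neq[OF q(1)] colour_eq by metis
  qed
qed

text \<open>For \<open>colour p \<noteq> colour q\<close>, the colours met on the way from \<open>p\<close> to \<open>q\<close>. Positions before the
  first cut have the last colour.\<close>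

definition colour_range :: "nat \<Rightarrow> nat \<Rightarrow> nat set" where
  "colour_range p q = (if cuts_before p = 0 then {1..cuts_before q} \<union> {num_colours..num_colours}
     else {cuts_before p..cuts_before q})"

lemma colour_in_range:
  assumes "p \<le> r" "r \<le> q"
  shows "colour r \<in> colour_range p q"
  using cuts_before_mono[OF assms(1)] cuts_before_mono[OF assms(2)]
  by (auto simp: colour_range_def colour_def)

text \<open>Cut counts are monotone, so outside the stretch from \<open>p\<close> to
  \<open>q\<close> only the two end colours of the range can recur.\<close>

lemma colour_in_range_outside:
  assumes "p < q" "colour p \<noteq> colour q" "r < p \<or> q < r" "colour r \<in> colour_range p q"
  shows "colour r = colour p \<or> colour r = colour q"
  using assms(3)
proof
  assume "r < p"
  then show ?thesis
    using assms(1,2,4) cuts_before_mono[of r p] cuts_before_mono[of p q] cuts_before_le[of q]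
    by (auto simp: colour_range_def colour_def split: if_splits)
next
  assume "q < r"
  then show ?thesis
    using assms(1,2,4) cuts_before_mono[of q r] cuts_before_mono[of p q] cuts_before_le[of q]
    by (auto simp: colour_range_def colour_def split: if_splits)
qed

end

section \<open>Labelings of the web\<close>

locale matching_web = noncrossing_matching "2 * k" M
  for k :: nat and M :: "nat set set" +
  fixes \<tt> :: weighted_dissection
  assumes k_pos: "1 \<le> k"
    and extending: "triangulation_extending (num_short_arcs (2 * k) M) (dissection_of (2 * k) M) \<tt>"
begin

sublocale triangulated_polygon "num_short_arcs (2 * k) M" \<tt>
  using extending by unfold_locales (simp add: triangulation_extending_def)

abbreviation W :: "(black_vertex, nat) web" where "W \<equiv> web_of (2 * k) M \<tt>"

abbreviation far :: "nat set \<Rightarrow> nat \<Rightarrow> nat set" where "far \<equiv> far_side num_colours"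

lemma n_pos: "1 \<le> 2 * k"
  using k_pos by simp

lemma card_matching: "card M = k"
proof -
  have "2 * card M = card (\<Union>M)"
    using partition perfect finite_matching
    by (intro card_partition) (auto simp: perfect_matching_def partition_on_def disjoint_def)
  also have "\<Union>M = {1..2 * k}" using partition by (simp add: partition_on_def)
  finally show ?thesis by simp
qed

text \<open>One formula for all edges: a diagonal added to the dissection has weight 0, and it joins
  the colours of no arc, since otherwise it would already belong to the dissection.\<close>

lemma weight_eq:
  assumes d: "d \<in> E"
  shows "weight \<tt> d = card {e \<in> M. colour ` e = d}"
proof -
  have chord: "d \<in> chords num_colours" using d edge_chord by blast
  have "weight \<tt> d = num_arcs_between (2 * k) M d"
  proof (cases "d \<in> diags (dissection_of (2 * k) M)")
    case True
    then have "weight \<tt> d = weight (dissection_of (2 * k) M) d"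
      using extending unfolding triangulation_extending_def by blast
    then show ?thesis by (simp add: dissection_of_def)
  next
    case False
    then have "weight \<tt> d = 0" using extending d unfolding triangulation_extending_def by blast
    moreover have "num_arcs_between (2 * k) M d = 0" using False chord by (simp add: dissection_of_def)
    ultimately show ?thesis by simp
  qed
  then show ?thesis using num_arcs_between_eq[OF chord] by simp
qed

lemma colour_arc_edge:
  assumes e: "e \<in> M"
  shows "colour ` e \<in> E"
proof -
  have "e \<in> {e' \<in> M. colour ` e' = colour ` e}" using e by simp
  then have "card {e' \<in> M. colour ` e' = colour ` e} > 0"
    using finite_matching(1) by (metis (no_types, lifting) card_gt_0_iff emptyE finite_subset mem_Collect_eq subsetI)
  then have "colour ` e \<in> diags (dissection_of (2 * k) M)"
    using num_arcs_between_eq colour_arc_chord[OF e] by (simp add: dissection_of_def)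
  then show ?thesis using extending unfolding triangulation_extending_def by blast
qed

text \<open>Grouping the arcs of \<open>M\<close> by their colour pairs, which are edges by
  \<open>colour_arc_edge\<close>, turns the sum of weights into a count.\<close>

lemma far_weight_eq: "far_weight num_colours \<tt> t a = card {e \<in> M. colour ` e \<subseteq> far t a}"
proof -
  let ?S = "{e \<in> M. colour ` e \<subseteq> far t a}" and ?T = "{d \<in> E. d \<subseteq> far t a}"
  have "far_weight num_colours \<tt> t a = (\<Sum>d\<in>?T. card {e \<in> M. colour ` e = d})"
    unfolding far_weight_def using weight_eq by (intro sum.cong) auto
  also have "\<dots> = (\<Sum>d\<in>?T. \<Sum>e\<in>{e \<in> ?S. colour ` e = d}. 1)"
    by (intro sum.cong) (auto intro: arg_cong[where f = card])
  also have "\<dots> = (\<Sum>e\<in>?S. 1)"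
    using finite_matching(1) finite_edges colour_arc_edge by (intro sum.group) auto
  finally show ?thesis by simp
qed

lemma edges_web: "edges W = {(Bdry i, colour i) | i. i \<in> {1..2 * k}} \<union>
    {(Tri t, a) | t a. t \<in> triangles \<tt> \<and> a \<in> t}"
proof -
  have "{(Bdry i, j) | i j. j \<in> {1..num_colours} \<and> i \<in> color_set (2 * k) M j} =
      {(Bdry i, colour i) | i. i \<in> {1..2 * k}}"
    using color_set_iff color_set_subset colour_bounds[OF n_pos] by blast
  then show ?thesis by (simp add: web_of_def Let_def)
qed

lemma boundary_in_edges: "(Bdry i, a) \<in> edges W \<longleftrightarrow> i \<in> {1..2 * k} \<and> a = colour i"
  and triangle_in_edges: "(Tri t, a) \<in> edges W \<longleftrightarrow> t \<in> triangles \<tt> \<and> a \<in> t"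
  unfolding edges_web by auto

lemma mult_boundary: "mult W (Bdry i, a) = 1"
  and mult_triangle: "mult W (Tri t, a) = card {e \<in> M. colour ` e \<subseteq> far t a}"
  using far_weight_eq by (simp_all add: web_of_def Let_def)

lemma boundary_edge_web: "i \<in> {1..2 * k} \<Longrightarrow> boundary_edge W (Bdry i) = (Bdry i, colour i)"
  unfolding boundary_edge_def by (rule the_equality) (auto simp: edges_web)

lemma boundary_word_iff: "boundary_word W l = map (\<lambda>x. {x}) (matching_word k M' \<nu>) \<longleftrightarrow>
    (\<forall>i\<in>{1..2 * k}. l (Bdry i, colour i) = {\<nu> (THE e. e \<in> M' \<and> i \<in> e)})"
proof -
  have "boundary W = map Bdry [1..<2 * k + 1]" by (simp add: web_of_def Let_def)
  then show ?thesis unfolding boundary_word_def matching_word_def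
    using boundary_edge_web by (auto simp: map_eq_conv simp del: upt_Suc)
qed

text \<open>The second alternative is a range of all colours, which is no proper interval;
  \<open>matchings_eq\<close> treats it separately.\<close>

lemma cyclic_interval_colour_range:
  assumes "p < q" "colour p \<noteq> colour q"
  shows "cyclic_interval (colour_range p q) \<or> {1..num_colours} \<subseteq> colour_range p q"
proof (cases "cuts_before p = 0")
  case True
  then have q: "1 \<le> cuts_before q" "cuts_before q < num_colours"
    using assms cuts_before_le[of q] by (auto simp: colour_def split: if_splits)
  show ?thesis
  proof (cases "cuts_before q + 1 = num_colours")
    case True
    then show ?thesis using \<open>cuts_before p = 0\<close> by (auto simp: colour_range_def)
  next
    case False
    then show ?thesis using True q unfolding cyclic_interval_def colour_range_def
      by (intro disjI1 disjI2 exI[of _ "cuts_before q"] exI[of _ num_colours]) auto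
  qed
next
  case False
  then have "cuts_before p \<le> cuts_before q" "cuts_before q \<le> num_colours"
    using assms cuts_before_mono cuts_before_le by auto
  then show ?thesis using False unfolding cyclic_interval_def colour_range_def by auto
qed

end

section \<open>Labels forced by the boundary word\<close>

text \<open>The matching \<open>M'\<close> may coincide with \<open>M\<close>, so the same facts
  give vanishing for other matchings and uniqueness for \<open>M\<close>.\<close>

locale matching_labeling = matching_web k M \<tt> + M': noncrossing_matching "2 * k" M'
  for k :: nat and M :: "nat set set" and \<tt> :: weighted_dissection and M' :: "nat set set" +
  fixes \<nu> :: "nat set \<Rightarrow> nat" and l :: "black_vertex \<times> nat \<Rightarrow> nat set"
  assumes numbering: "bij_betw \<nu> M' {1..k}"
    and consistent: "consistent_labeling k W l"
    and word: "boundary_word W l = map (\<lambda>x. {x}) (matching_word k M' \<nu>)"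
begin

lemma label_boundary:
  assumes e: "e \<in> M'" "i \<in> e"
  shows "l (Bdry i, colour i) = {\<nu> e}"
proof -
  have "i \<in> {1..2 * k}" using e M'.partition unfolding partition_on_def by blast
  then show ?thesis using word M'.the_arc[OF e] unfolding boundary_word_iff by metis
qed

lemma label_disjoint:
  assumes "e \<in> edges W" "e' \<in> edges W" "e \<noteq> e'" "fst e = fst e' \<or> snd e = snd e'"
  shows "l e \<inter> l e' = {}"
  using consistent assms by (simp add: consistent_labeling_def)

lemma label_disjoint_white:
  "(v, a) \<in> edges W \<Longrightarrow> (v', a) \<in> edges W \<Longrightarrow> x \<in> l (v, a) \<Longrightarrow> x \<in> l (v', a) \<Longrightarrow> v = v'"
  using label_disjoint[of "(v, a)" "(v', a)"] by auto

lemma label_disjoint_black: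
  "(v, a) \<in> edges W \<Longrightarrow> (v, a') \<in> edges W \<Longrightarrow> a \<noteq> a' \<Longrightarrow> l (v, a) \<inter> l (v, a') = {}"
  using label_disjoint[of "(v, a)" "(v, a')"] by simp

lemma card_label: "t \<in> triangles \<tt> \<Longrightarrow> a \<in> t \<Longrightarrow> card (l (Tri t, a)) = card {e \<in> M. colour ` e \<subseteq> far t a}"
  using consistent triangle_in_edges[of t a] mult_triangle[of t a]
  unfolding consistent_labeling_def by metis

lemma label_subset: "t \<in> triangles \<tt> \<Longrightarrow> a \<in> t \<Longrightarrow> l (Tri t, a) \<subseteq> {1..k}"
  using consistent triangle_in_edges[of t a] unfolding consistent_labeling_def by blast

lemma finite_label: "t \<in> triangles \<tt> \<Longrightarrow> a \<in> t \<Longrightarrow> finite (l (Tri t, a))"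
  using finite_subset[OF label_subset] by simp

text \<open>Otherwise two boundary edges at one white vertex would carry the same symbol.\<close>

lemma colour_arc_neq': "{p, q} \<in> M' \<Longrightarrow> colour p \<noteq> colour q"
proof
  assume pq: "{p, q} \<in> M'" "colour p = colour q"
  have "p \<in> {1..2 * k}" "q \<in> {1..2 * k}" "p \<noteq> q" using M'.arc_bounds[OF pq(1)] by auto
  moreover have "l (Bdry p, colour p) = {\<nu> {p, q}}" "l (Bdry q, colour p) = {\<nu> {p, q}}"
    using label_boundary[OF pq(1), of p] label_boundary[OF pq(1), of q] pq(2) by simp_all
  ultimately have "Bdry p = Bdry q"
    using label_disjoint_white[of "Bdry p" "colour p" "Bdry q" "\<nu> {p, q}"] pq(2)
    by (simp add: boundary_in_edges)
  then show False using \<open>p \<noteq> q\<close> by simp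
qed

text \<open>The labels at \<open>t\<close> are disjoint, and their sizes add up to at least
  \<open>card M = k\<close>, because every arc of \<open>M\<close> has its colours on some far side.
  Hence they exhaust all symbols.\<close>

lemma triangle_labels_cover:
  assumes t: "t \<in> triangles \<tt>" and x: "x \<in> {1..k}"
  shows "\<exists>v\<in>t. x \<in> l (Tri t, v)"
proof -
  have "M \<subseteq> (\<Union>v\<in>t. {e \<in> M. colour ` e \<subseteq> far t v})"
  proof
    fix e assume e: "e \<in> M"
    then obtain v where "v \<in> t" "colour ` e \<subseteq> far t v"
      using far_sides_cover[OF t colour_arc_edge] by blast
    with e show "e \<in> (\<Union>v\<in>t. {e \<in> M. colour ` e \<subseteq> far t v})" by blast
  qed
  moreover have "finite (\<Union>v\<in>t. {e \<in> M. colour ` e \<subseteq> far t v})"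
    using finite_matching finite_triangle[OF t] by auto
  ultimately have "card M \<le> card (\<Union>v\<in>t. {e \<in> M. colour ` e \<subseteq> far t v})" by (rule card_mono[rotated])
  also have "\<dots> \<le> (\<Sum>v\<in>t. card {e \<in> M. colour ` e \<subseteq> far t v})"
    using finite_triangle[OF t] by (rule card_UN_le)
  also have "\<dots> = (\<Sum>v\<in>t. card (l (Tri t, v)))" using card_label[OF t] by simp
  also have "\<dots> = card (\<Union>v\<in>t. l (Tri t, v))"
    using finite_triangle[OF t] finite_label[OF t] label_disjoint_black t
    by (intro card_UN_disjoint[symmetric]) (auto simp: triangle_in_edges)
  finally have "card {1..k} \<le> card (\<Union>v\<in>t. l (Tri t, v))" using card_matching by simp
  moreover have "(\<Union>v\<in>t. l (Tri t, v)) \<subseteq> {1..k}" using label_subset[OF t] by blast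
  ultimately have "(\<Union>v\<in>t. l (Tri t, v)) = {1..k}" by (intro card_seteq) auto
  then show ?thesis using x by blast
qed

text \<open>The symbol of \<open>e\<close> picks a vertex \<open>f t\<close> of each triangle.
  Disjointness at white vertices makes \<open>f\<close> injective and keeps it away from the two
  colours of \<open>e\<close>, where boundary edges already carry the symbol, so
  \<open>matching_escapes\<close> applies.\<close>

lemma label_escapes:
  assumes e: "e \<in> M'" and A: "cyclic_interval A" "colour ` e \<subseteq> A"
  shows "\<exists>t\<in>heavy A. \<exists>v\<in>t - A. \<nu> e \<in> l (Tri t, v)"
proof -
  have x: "\<nu> e \<in> {1..k}" using numbering e bij_betwE by blast
  obtain p q where pq: "p < q" "e = {p, q}" using M'.arcE[OF e] .
  have b: "p \<in> {1..2 * k}" "q \<in> {1..2 * k}" using M'.arc_bounds[of p q] e pq by auto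
  obtain f where f: "f t \<in> t \<and> \<nu> e \<in> l (Tri t, f t)" if "t \<in> triangles \<tt>" for t
    using triangle_labels_cover[OF _ x] by metis
  have f_neq: "f t \<noteq> colour i" if t: "t \<in> triangles \<tt>" and i: "i \<in> e" for t i
  proof
    assume eq: "f t = colour i"
    have "(Bdry i, colour i) \<in> edges W" using i b pq by (auto simp: boundary_in_edges)
    moreover have "(Tri t, colour i) \<in> edges W" using f[OF t] t eq by (simp add: triangle_in_edges)
    ultimately have "Bdry i = Tri t"
      using label_disjoint_white label_boundary[OF e i] f[OF t] eq by (metis singletonI)
    then show False by simp
  qed
  have "inj_on f (triangles \<tt>)"
  proof (rule inj_onI)
    fix t t' assume t: "t \<in> triangles \<tt>" "t' \<in> triangles \<tt>" "f t = f t'"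
    then have "Tri t = Tri t'"
      using f[OF t(1)] f[OF t(2)] label_disjoint_white[of "Tri t" "f t" "Tri t'" "\<nu> e"]
      by (simp add: triangle_in_edges)
    then show "t = t'" by simp
  qed
  moreover have "f t \<in> t - {colour p, colour q}" if "t \<in> triangles \<tt>" for t
    using f[OF that] f_neq[OF that, of p] f_neq[OF that, of q] pq by simp
  moreover have "colour p \<noteq> colour q" using colour_arc_neq' e pq by blast
  moreover have "colour p \<in> A" "colour q \<in> A" using A(2) pq by auto
  ultimately obtain t where t: "t \<in> heavy A" "f t \<in> t - A"
    using matching_escapes[OF A(1)] by blast
  moreover have "t \<in> triangles \<tt>" using t by (simp add: heavy_def)
  ultimately show ?thesis using f by blast
qed

text \<open>For the far side of \<open>t\<close> opposite \<open>v\<close>,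
  \<open>triangle_across\<close> leaves only the edge from \<open>t\<close> to \<open>v\<close> as a
  place where the symbol can escape.\<close>

lemma label_forced:
  assumes t: "t \<in> triangles \<tt>" "v \<in> t" and e: "e \<in> M'" "colour ` e \<subseteq> far t v"
  shows "\<nu> e \<in> l (Tri t, v)"
proof -
  obtain t' v' where *: "t' \<in> heavy (far t v)" "v' \<in> t' - far t v" "\<nu> e \<in> l (Tri t', v')"
    using label_escapes[OF e(1) cyclic_interval_far_side[OF t] e(2)] by blast
  then show ?thesis using triangle_across[OF t *(1,2)] by simp
qed

lemma matchings_eq: "M' = M"
proof (rule noncrossing_matching_eqI)
  show "noncrossing_matching (2 * k) M'" "noncrossing_matching (2 * k) M" by unfold_locales
  fix p q assume pq: "{p, q} \<in> M'" "p < q"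
    and agree: "\<And>u v. p < u \<Longrightarrow> u < q \<Longrightarrow> {u, v} \<in> M \<longleftrightarrow> {u, v} \<in> M'"
  have inner: "p < v \<and> v < q" if "p < u" "u < q" "{u, v} \<in> M" for u v
    using agree that M'.nested[OF pq(1)] by blast
  have b: "p \<in> {1..2 * k}" "q \<in> {1..2 * k}" using M'.arc_bounds[OF pq(1)] by auto
  have neq: "colour p \<noteq> colour q" using colour_arc_neq'[OF pq(1)] .
  show "{p, q} \<in> M"
  proof (rule ccontr)
    assume pq_M: "{p, q} \<notin> M"
    \<comment> \<open>An arc of \<open>M\<close> not inside {p, q} can have colours in the range
      only if they are those of \<open>p\<close> and \<open>q\<close>; suitably oriented, it is
      ruled out by \<open>no_equicoloured_outer_arc\<close>.\<close>
    have no_outer: False if gh: "{g, h} \<in> M" "\<not> (p < g \<and> g < q)" "colour ` {g, h} \<subseteq> colour_range p q"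
      for g h
    proof -
      have h: "\<not> (p < h \<and> h < q)" using inner[of h g] gh(1,2) by (auto simp: insert_commute)
      have outer: "colour r = colour p \<or> colour r = colour q"
        if "\<not> (p < r \<and> r < q)" "colour r \<in> colour_range p q" for r
        using colour_in_range_outside[OF pq(2) neq _ that(2)] that(1)
        by (cases "r = p \<or> r = q") auto
      have "colour g \<noteq> colour h" using colour_arc_neq[OF gh(1)] .
      then consider "colour g = colour p" "colour h = colour q"
        | "colour h = colour p" "colour g = colour q"
        using outer[of g] outer[of h] gh(2,3) h by auto
      then show False
      proof cases
        case 1
        show False
          by (rule no_equicoloured_outer_arc[OF pq(2) b pq_M neq _ gh(1,2) 1]) (use inner in blast)
      next
        case 2
        have "{h, g} \<in> M" using gh(1) by (simp add: insert_commute)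
        then show False
          by (rule no_equicoloured_outer_arc[OF pq(2) b pq_M neq _ _ h 2, rotated]) (use inner in blast)
      qed
    qed
    have arc_M': "e \<in> M' \<and> e \<noteq> {p, q}" if e: "e \<in> M" "colour ` e \<subseteq> colour_range p q" for e
    proof -
      obtain g h where gh: "e = {g, h}" using arcE[OF e(1)] by blast
      then have "p < g \<and> g < q" using no_outer[of g h] e by blast
      then show ?thesis using agree[of g h] gh e pq_M by auto
    qed
    show False
    proof (cases "{1..num_colours} \<subseteq> colour_range p q")
      case True
      \<comment> \<open>This arc has its colours in the range, although \<open>p\<close> is not
        strictly inside the stretch.\<close>
      obtain p' where "{p, p'} \<in> M" using partner[OF b(1)] by blast
      then show False using no_outer[of p p'] True colour_bounds[OF n_pos] by blast
    next
      case False
      then have A: "cyclic_interval (colour_range p q)"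
        using cyclic_interval_colour_range[OF pq(2) neq] by blast
      have "colour ` {p, q} \<subseteq> colour_range p q" using colour_in_range[of p _ q] pq(2) by auto
      then obtain t v where t: "t \<in> heavy (colour_range p q)" "v \<in> t - colour_range p q"
        "\<nu> {p, q} \<in> l (Tri t, v)"
        using label_escapes[OF pq(1) A] by blast
      then have T: "t \<in> triangles \<tt>" "v \<in> t" by (auto simp: heavy_def)
      let ?Y = "{e \<in> M. colour ` e \<subseteq> far t v}"
      have Y: "e \<in> M' \<and> e \<noteq> {p, q}" if "e \<in> ?Y" for e
        using that arc_M' far_side_subset[OF A t(1,2)] by blast
      \<comment> \<open>All arcs counted by the multiplicity are forced onto this edge, and the
        symbol of {p, q} is one more.\<close>
      have "\<nu> ` insert {p, q} ?Y \<subseteq> l (Tri t, v)" using label_forced[OF T] Y t(3) by auto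
      then have "card (\<nu> ` insert {p, q} ?Y) \<le> card (l (Tri t, v))"
        using finite_label[OF T] by (rule card_mono[rotated])
      also have "card (\<nu> ` insert {p, q} ?Y) = card (insert {p, q} ?Y)"
        using Y pq(1) inj_on_subset[OF bij_betw_imp_inj_on[OF numbering]] by (intro card_image) blast
      also have "\<dots> = Suc (card ?Y)" using Y finite_matching by (intro card_insert_disjoint) auto
      finally show False using card_label[OF T] by simp
    qed
  qed
qed

text \<open>The forced labels already fill the multiplicity.\<close>

lemma label_triangle:
  assumes t: "t \<in> triangles \<tt>" "v \<in> t"
  shows "l (Tri t, v) = \<nu> ` {e \<in> M. colour ` e \<subseteq> far t v}"
proof (rule sym, rule card_seteq)
  show "finite (l (Tri t, v))" using finite_label[OF t] .
  show "\<nu> ` {e \<in> M. colour ` e \<subseteq> far t v} \<subseteq> l (Tri t, v)"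
    using label_forced[OF t] matchings_eq by auto
  have "inj_on \<nu> {e \<in> M. colour ` e \<subseteq> far t v}"
    using inj_on_subset[OF bij_betw_imp_inj_on[OF numbering]] matchings_eq by auto
  then show "card (l (Tri t, v)) \<le> card (\<nu> ` {e \<in> M. colour ` e \<subseteq> far t v})"
    using card_label[OF t] by (simp add: card_image)
qed

end

section \<open>The forced labeling and its consistency\<close>

context matching_web
begin

text \<open>The only candidate, by \<open>label_boundary\<close> and \<open>label_triangle\<close>;
  \<open>restrict\<close> makes it extensional on the edge set.\<close>

definition labeling :: "(nat set \<Rightarrow> nat) \<Rightarrow> black_vertex \<times> nat \<Rightarrow> nat set" where
  "labeling \<nu> = restrict (\<lambda>(b, a). case b of
       Bdry i \<Rightarrow> {\<nu> (THE e. e \<in> M \<and> i \<in> e)}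
     | Tri t \<Rightarrow> \<nu> ` {e \<in> M. colour ` e \<subseteq> far t a}) (edges W)"

lemma labeling_boundary:
  assumes "e \<in> M" "i \<in> e"
  shows "labeling \<nu> (Bdry i, colour i) = {\<nu> e}"
proof -
  have "i \<in> {1..2 * k}" using assms partition unfolding partition_on_def by blast
  then show ?thesis using the_arc[OF assms] by (simp add: labeling_def boundary_in_edges)
qed

lemma labeling_triangle: "t \<in> triangles \<tt> \<Longrightarrow> a \<in> t \<Longrightarrow>
    labeling \<nu> (Tri t, a) = \<nu> ` {e \<in> M. colour ` e \<subseteq> far t a}"
  by (simp add: labeling_def triangle_in_edges)

lemma arc_of:
  assumes "i \<in> {1..2 * k}"
  obtains e where "e \<in> M" "i \<in> e"
  using assms partition unfolding partition_on_def by blast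

lemma vertex_notin_far: "t \<in> triangles \<tt> \<Longrightarrow> a \<in> t \<Longrightarrow> a \<notin> far t a"
  by (erule (1) far_side_cases) auto

lemma consistent_labeling:
  assumes \<nu>: "bij_betw \<nu> M {1..k}"
  shows "consistent_labeling k W (labeling \<nu>)"
  unfolding consistent_labeling_def
proof (intro conjI ballI impI)
  note inj = bij_betw_imp_inj_on[OF \<nu>]
  have img: "\<nu> e \<in> {1..k}" if "e \<in> M" for e using \<nu> that bij_betwE by blast
  show "labeling \<nu> \<in> edges W \<rightarrow>\<^sub>E Pow {1..k}"
  proof
    fix x assume "x \<in> edges W"
    then show "labeling \<nu> x \<in> Pow {1..k}" unfolding edges_web
    proof (elim UnE CollectE exE conjE)
      fix i assume i: "x = (Bdry i, colour i)" "i \<in> {1..2 * k}"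
      obtain e where "e \<in> M" "i \<in> e" using arc_of[OF i(2)] .
      then show ?thesis using labeling_boundary img i by simp
    next
      fix t a assume "x = (Tri t, a)" "t \<in> triangles \<tt>" "a \<in> t"
      then show ?thesis using labeling_triangle img by auto
    qed
  qed (simp add: labeling_def)
  show "card (labeling \<nu> x) = mult W x" if "x \<in> edges W" for x
    using that unfolding edges_web
  proof (elim UnE CollectE exE conjE)
    fix i assume i: "x = (Bdry i, colour i)" "i \<in> {1..2 * k}"
    obtain e where "e \<in> M" "i \<in> e" using arc_of[OF i(2)] .
    then show ?thesis using labeling_boundary i by (simp add: mult_boundary)
  next
    fix t a assume *: "x = (Tri t, a)" "t \<in> triangles \<tt>" "a \<in> t"
    have "inj_on \<nu> {e \<in> M. colour ` e \<subseteq> far t a}" using inj by (rule inj_on_subset) auto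
    then show ?thesis using labeling_triangle * by (simp add: mult_triangle card_image)
  qed
  \<comment> \<open>Positions of equal colour lie on different arcs, since no arc is
    monochromatic.\<close>
  have bdry_bdry: "labeling \<nu> (Bdry i, colour i) \<inter> labeling \<nu> (Bdry j, colour j) = {}"
    if i: "i \<in> {1..2 * k}" and j: "j \<in> {1..2 * k}" and ij: "i \<noteq> j" "colour i = colour j" for i j
  proof -
    obtain e where e: "e \<in> M" "i \<in> e" using arc_of[OF i] .
    obtain e' where e': "e' \<in> M" "j \<in> e'" using arc_of[OF j] .
    have "e \<noteq> e'"
    proof
      assume "e = e'"
      moreover obtain p q where "e = {p, q}" using arcE[OF e(1)] by blast
      ultimately have "{i, j} \<in> M" using e e' ij(1) by (auto simp: insert_commute)
      then show False using colour_arc_neq ij(2) by blast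
    qed
    then have "\<nu> e \<noteq> \<nu> e'" using inj_onD[OF inj] e e' by blast
    then show ?thesis using labeling_boundary[OF e] labeling_boundary[OF e'] by simp
  qed
  \<comment> \<open>A far side does not contain the vertex opposite to it, so no arc with an end of
    this colour is counted on the triangle edge.\<close>
  have bdry_tri: "labeling \<nu> (Bdry i, colour i) \<inter> labeling \<nu> (Tri t, colour i) = {}"
    if i: "i \<in> {1..2 * k}" and t: "t \<in> triangles \<tt>" "colour i \<in> t" for i t
  proof -
    obtain e where e: "e \<in> M" "i \<in> e" using arc_of[OF i] .
    have "\<nu> e \<notin> labeling \<nu> (Tri t, colour i)"
    proof
      assume "\<nu> e \<in> labeling \<nu> (Tri t, colour i)"
      then obtain e' where "e' \<in> M" "colour ` e' \<subseteq> far t (colour i)" "\<nu> e = \<nu> e'"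
        using labeling_triangle t by auto
      moreover have "e = e'" using inj_onD[OF inj] e calculation by blast
      ultimately show False using vertex_notin_far[OF t] e by blast
    qed
    then show ?thesis using labeling_boundary[OF e] by simp
  qed
  \<comment> \<open>An arc on both edges is excluded by \<open>far_sides_disjoint\<close> at a
    common black vertex and by \<open>common_far_side\<close> at a common white vertex.\<close>
  have tri_tri: "labeling \<nu> (Tri t, a) \<inter> labeling \<nu> (Tri t', a') = {}"
    if t: "t \<in> triangles \<tt>" "a \<in> t" "t' \<in> triangles \<tt>" "a' \<in> t'"
      and or: "t = t' \<and> a \<noteq> a' \<or> t \<noteq> t' \<and> a = a'" for t a t' a'
  proof (rule ccontr)
    assume "\<not> ?thesis"
    then obtain x where "x \<in> labeling \<nu> (Tri t, a)" "x \<in> labeling \<nu> (Tri t', a')" by blast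
    then obtain e e' where e: "e \<in> M" "colour ` e \<subseteq> far t a" and e': "e' \<in> M" "colour ` e' \<subseteq> far t' a'"
      and "\<nu> e = \<nu> e'" using labeling_triangle t by auto
    then have "e = e'" using inj_onD[OF inj] by blast
    with or show False
      using far_sides_disjoint[OF t(1) colour_arc_edge[OF e(1)], of a a'] t e e'
        common_far_side[OF t(1) t(2) t(3) _ colour_arc_edge[OF e(1)]] by blast
  qed
  fix x y assume x: "x \<in> edges W" and y: "y \<in> edges W"
    and xy: "x \<noteq> y \<and> (fst x = fst y \<or> snd x = snd y)"
  consider (bb) i j where "x = (Bdry i, colour i)" "i \<in> {1..2 * k}" "y = (Bdry j, colour j)" "j \<in> {1..2 * k}"
    | (bt) i t a where "x = (Bdry i, colour i)" "i \<in> {1..2 * k}" "y = (Tri t, a)" "t \<in> triangles \<tt>" "a \<in> t"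
    | (tb) i t a where "y = (Bdry i, colour i)" "i \<in> {1..2 * k}" "x = (Tri t, a)" "t \<in> triangles \<tt>" "a \<in> t"
    | (tt) t a t' a' where "x = (Tri t, a)" "t \<in> triangles \<tt>" "a \<in> t"
      "y = (Tri t', a')" "t' \<in> triangles \<tt>" "a' \<in> t'"
    using x y unfolding edges_web by blast
  then show "labeling \<nu> x \<inter> labeling \<nu> y = {}"
  proof cases
    case (bb i j)
    then show ?thesis using bdry_bdry[of i j] xy by auto
  next
    case (bt i t a)
    then show ?thesis using bdry_tri[of i t] xy by auto
  next
    case (tb i t a)
    then show ?thesis using bdry_tri[of i t] xy by auto
  next
    case (tt t a t' a')
    then show ?thesis using tri_tri[of t a t' a'] xy by auto
  qed
qed

lemma labeling_unique:
  assumes \<nu>: "bij_betw \<nu> M {1..k}"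
  shows "{l. consistent_labeling k W l \<and> boundary_word W l = map (\<lambda>x. {x}) (matching_word k M \<nu>)} =
    {labeling \<nu>}"
proof (intro equalityI subsetI)
  fix l assume l: "l \<in> {l. consistent_labeling k W l \<and>
    boundary_word W l = map (\<lambda>x. {x}) (matching_word k M \<nu>)}"
  interpret matching_labeling k M \<tt> M \<nu> l
    using l \<nu> by unfold_locales simp_all
  have "l = labeling \<nu>"
  proof
    fix x
    show "l x = labeling \<nu> x"
    proof (cases "x \<in> edges W")
      case True
      then show ?thesis unfolding edges_web
      proof (elim UnE CollectE exE conjE)
        fix i assume i: "x = (Bdry i, colour i)" "i \<in> {1..2 * k}"
        obtain e where "e \<in> M" "i \<in> e" using arc_of[OF i(2)] .
        then show ?thesis using label_boundary labeling_boundary i by simp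
      next
        fix t a assume "x = (Tri t, a)" "t \<in> triangles \<tt>" "a \<in> t"
        then show ?thesis using label_triangle labeling_triangle by simp
      qed
    next
      case False
      have "l \<in> edges W \<rightarrow>\<^sub>E Pow {1..k}" using consistent by (simp add: consistent_labeling_def)
      then show ?thesis using False by (simp add: PiE_arb[OF _ False] labeling_def)
    qed
  qed
  then show "l \<in> {labeling \<nu>}" by simp
next
  fix l assume "l \<in> {labeling \<nu>}"
  moreover have "boundary_word W (labeling \<nu>) = map (\<lambda>x. {x}) (matching_word k M \<nu>)"
    unfolding boundary_word_iff by (simp add: labeling_def boundary_in_edges)
  ultimately show "l \<in> {l. consistent_labeling k W l \<and>
    boundary_word W l = map (\<lambda>x. {x}) (matching_word k M \<nu>)}"
    using consistent_labeling[OF \<nu>] by simp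
qed

end

section \<open>The two values of the labeling count\<close>

theorem mainTheorem5:
  fixes k :: nat
    and T :: "nat \<Rightarrow> nat \<Rightarrow> nat"
    and M :: "nat set set"
    and \<tt> :: weighted_dissection
    and W :: "(black_vertex, nat) web"
  assumes "k \<ge> 1"
    and "two_column_SYT k T"
    and "M = matching_of k T"
    and "triangulation_extending (num_short_arcs (2 * k) M) (dissection_of (2 * k) M) \<tt>"
    and "W = web_of (2 * k) M \<tt>"
  shows "(\<forall>\<nu>. bij_betw \<nu> M {1..k} \<longrightarrow> num_labelings k W (matching_word k M \<nu>) = 1) \<and>
    (\<forall>M' \<nu>. perfect_matching (2 * k) M' \<and> noncrossing M' \<and> M' \<noteq> M \<and> bij_betw \<nu> M' {1..k}
       \<longrightarrow> num_labelings k W (matching_word k M' \<nu>) = 0)"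
proof -
  interpret noncrossing_matching "2 * k" M
    using noncrossing_matching_of[OF assms(2)] assms(3) by simp
  interpret mw: matching_web k M \<tt>
    using assms(1,4) by unfold_locales
  show ?thesis
  proof (intro conjI allI impI)
    fix \<nu> assume "bij_betw \<nu> M {1..k}"
    then show "num_labelings k W (matching_word k M \<nu>) = 1"
      unfolding num_labelings_def assms(5) by (simp add: mw.labeling_unique)
  next
    fix M' \<nu>
    assume M': "perfect_matching (2 * k) M' \<and> noncrossing M' \<and> M' \<noteq> M \<and> bij_betw \<nu> M' {1..k}"
    have "{l. consistent_labeling k W l \<and> boundary_word W l = map (\<lambda>x. {x}) (matching_word k M' \<nu>)} = {}"
    proof (rule ccontr)
      assume "\<not> ?thesis"
      then obtain l where "consistent_labeling k W l"
        "boundary_word W l = map (\<lambda>x. {x}) (matching_word k M' \<nu>)" by blast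
      then interpret matching_labeling k M \<tt> M' \<nu> l
        using M' assms(5) by unfold_locales simp_all
      show False using matchings_eq M' by simp
    qed
    then show "num_labelings k W (matching_word k M' \<nu>) = 0"
      unfolding num_labelings_def by (simp only: card.empty)
  qed
qed

end
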